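(* Let $\mathbf u=\begin{bmatrix} a\\ b\end{bmatrix}$ and $\mathbf v=\begin{bmatrix} c\\ d\end{bmatrix}$ be two neighboring spinors in the corona around a disk of curvature $B$ in an Apollonian disk packing (that is, tangency spinors oriented from this disk towards two mutually tangent disks of its corona). Let $$M=[\mathbf u|\mathbf v]=\begin{bmatrix} a& c\\ b& d\end{bmatrix},\qquad \mathbf f=\begin{bmatrix} m\\ n\end{bmatrix}.$$ Then the quadratic polynomial $$P(m,n)=\mathbf f^T(M^TM)\,\mathbf f-B$$ reproduces all curvatures in the corona of the disk of curvature $B$, with $(m,n)\in\mathbb Z^2$ running over all pairs of coprime integers, including $(\pm1,0)$ and $(0,\pm1)$. Each curvature appears in the range of the polynomial twice, due to $P(\mathbf f)=P(-\mathbf f)$.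
   Context: Disks. Disks in the plane $\mathbb R^2\cong\mathbb C$ are understood in the generalized sense: an ordinary round disk of radius $r>0$ has curvature $1/r$; the unbounded region outside a circle of radius $r>0$ is a disk of curvature $-1/r$ (with the same center as the circle); a half-plane is a disk of curvature $0$. Tangent disks are always tangent externally (disjoint interiors); two parallel half-planes with disjoint interiors count as tangent. An Apollonian disk packing is the infinite arrangement of disks determined by three mutually tangent disks by recurrently adjoining, for every three mutually tangent disks present, the disks tangent to all three. The corona of a disk in the packing is the set of all disks of the packing tangent to it. Tangency spinor. For an ordered pair of tangent disks of curvatures $A_1$ and $A_2$, the tangency spinor is $u=\pm\sqrt{A_1A_2\,z}$, where $z\in\mathbb C$ represents the vector joining the center of the first disk to the center of the second. It is defined up to sign and satisfies $|u|^2=A_1+A_2$. Equivalently, $u^2=(A_1+A_2)e$, where $e$ is the unit normal at the tangency point pointing out of the first disk; this form also makes sense when one of the disks is a half-plane (and $u=0$ if both are). The complex number $u=p+qi$ is identified with the vector $\begin{bmatrix} p\\ q\end{bmatrix}\in\mathbb R^2$. *)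

theory Defs
  imports "HOL-Analysis.Analysis"
begin

text \<open>
  \<open>Halfplane e t\<close> is the half-plane with outward unit normal \<open>e\<close> at signed distance \<open>t\<close>
  from the origin; \<open>Codisk c r\<close> is the closed region outside the circle of radius \<open>r\<close>
  around \<open>c\<close>. Distinct values satisfying \<open>valid_disk\<close> have distinct regions.
\<close>

datatype gdisk =
    Disk complex real
  | Codisk complex real
  | Halfplane complex real

primrec valid_disk :: "gdisk \<Rightarrow> bool" where
  "valid_disk (Disk c r) \<longleftrightarrow> r > 0"
| "valid_disk (Codisk c r) \<longleftrightarrow> r > 0"
| "valid_disk (Halfplane e t) \<longleftrightarrow> norm e = 1"

primrec region :: "gdisk \<Rightarrow> complex set" where
  "region (Disk c r) = cball c r"
| "region (Codisk c r) = - ball c r"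
| "region (Halfplane e t) = {z. e \<bullet> z \<le> t}"

primrec curvature :: "gdisk \<Rightarrow> real" where
  "curvature (Disk c r) = 1 / r"
| "curvature (Codisk c r) = - 1 / r"
| "curvature (Halfplane e t) = 0"

primrec center :: "gdisk \<Rightarrow> complex option" where
  "center (Disk c r) = Some c"
| "center (Codisk c r) = Some c"
| "center (Halfplane e t) = None"

text \<open>The unit normal at a boundary point \<open>p\<close> pointing out of the region.\<close>

primrec outward_normal :: "gdisk \<Rightarrow> complex \<Rightarrow> complex" where
  "outward_normal (Disk c r) p = (p - c) / of_real r"
| "outward_normal (Codisk c r) p = (c - p) / of_real r"
| "outward_normal (Halfplane e t) p = e"

text \<open>External tangency; the last disjunct is tangency at infinity of parallel half-planes.\<close>

definition tangent :: "gdisk \<Rightarrow> gdisk \<Rightarrow> bool" where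
  "tangent D E \<longleftrightarrow> valid_disk D \<and> valid_disk E \<and>
     interior (region D) \<inter> interior (region E) = {} \<and>
     ((\<exists>p. region D \<inter> region E = {p}) \<or>
      (\<exists>e s t. D = Halfplane e s \<and> E = Halfplane (- e) t))"

definition mutually_tangent :: "gdisk \<Rightarrow> gdisk \<Rightarrow> gdisk \<Rightarrow> bool" where
  "mutually_tangent D E F \<longleftrightarrow> tangent D E \<and> tangent E F \<and> tangent D F"

inductive_set apollonian_disks :: "gdisk \<Rightarrow> gdisk \<Rightarrow> gdisk \<Rightarrow> gdisk set"
  for D1 D2 D3 :: gdisk where
  first: "D1 \<in> apollonian_disks D1 D2 D3"
| second: "D2 \<in> apollonian_disks D1 D2 D3"
| third: "D3 \<in> apollonian_disks D1 D2 D3"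
| adjoin: "\<lbrakk>X \<in> apollonian_disks D1 D2 D3; Y \<in> apollonian_disks D1 D2 D3;
     Z \<in> apollonian_disks D1 D2 D3; mutually_tangent X Y Z;
     tangent W X; tangent W Y; tangent W Z\<rbrakk> \<Longrightarrow> W \<in> apollonian_disks D1 D2 D3"

definition apollonian_packing :: "gdisk set \<Rightarrow> bool" where
  "apollonian_packing \<A> \<longleftrightarrow>
     (\<exists>D1 D2 D3. mutually_tangent D1 D2 D3 \<and> \<A> = apollonian_disks D1 D2 D3)"

definition corona :: "gdisk set \<Rightarrow> gdisk \<Rightarrow> gdisk set" where
  "corona \<A> D = {E \<in> \<A>. tangent D E}"

text \<open>
  Spinors are determined only up to sign, hence a relation. When a half-plane is involved the
  centre-to-centre formula is replaced by \<open>u\<^sup>2 = (A\<^sub>1 + A\<^sub>2) e\<close>, with \<open>e\<close> the normal out of the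
  first disk at the tangency point.
\<close>

definition tangency_spinor :: "gdisk \<Rightarrow> gdisk \<Rightarrow> complex \<Rightarrow> bool" where
  "tangency_spinor D E u \<longleftrightarrow> tangent D E \<and>
     (case (center D, center E) of
        (Some c, Some c') \<Rightarrow> u\<^sup>2 = of_real (curvature D * curvature E) * (c' - c)
      | (None, None) \<Rightarrow> u = 0
      | _ \<Rightarrow> (\<exists>p. region D \<inter> region E = {p} \<and>
               u\<^sup>2 = of_real (curvature D + curvature E) * outward_normal D p))"

definition corona_poly :: "real^2^2 \<Rightarrow> real \<Rightarrow> int \<times> int \<Rightarrow> real" where
  "corona_poly M B = (\<lambda>(m, n). let f = vector [of_int m, of_int n] :: real^2
     in f \<bullet> ((transpose M ** M) *v f) - B)"

definition coprime_pairs :: "(int \<times> int) set" where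
  "coprime_pairs = {(m, n). coprime m n}"

end

theory Submission
  imports Defs
begin

text \<open>
  A disk is encoded by its inversive coordinates, a vector of norm 1 in a Lorentz space of
  signature (3,1). External tangency means that the product is -1 and that the sum, which is then
  a null vector, points to the future. Four mutually tangent disks form a basis with Gram matrix
  2I - J, and exchanging one of them for the other disk tangent to the remaining three is a linear
  reflection. Along a path of exchanges without backtracking, a functional such as the negated product
  with a fixed disk grows as soon as the path exchanges that disk. Hence every tangent pair and every
  mutually tangent triple of the packing occurs in one common quadruple, and the corona of \<open>D\<close>
  consists of the disks met while \<open>D\<close> is kept fixed. With \<open>D\<close> fixed, the null vectors \<open>D + X\<close> are
  the values of a quadratic form: if \<open>E\<close> and \<open>F\<close> correspond to \<open>(1,0)\<close> and \<open>(0,1)\<close>, the exchanges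
  are the parallelogram law, so the Euclidean algorithm reaches exactly the coprime pairs.
  Comparing the curvature coordinate of this form with the spinors gives the polynomial.
\<close>

section \<open>Inversive coordinates\<close>

text \<open>Curvature \<open>b\<close>, curvature times center, and co-curvature \<open>b(|c|\<^sup>2 - r\<^sup>2)\<close>.\<close>

type_synonym lvec = "real \<times> complex \<times> real"

abbreviation cv :: "lvec \<Rightarrow> real" where "cv x \<equiv> fst x"
abbreviation mid :: "lvec \<Rightarrow> complex" where "mid x \<equiv> fst (snd x)"
abbreviation cocv :: "lvec \<Rightarrow> real" where "cocv x \<equiv> snd (snd x)"

text \<open>For round disks this is \<open>(r^2 + s^2 - |c - d|^2) / (2 r s)\<close>, which equals
  -1 exactly when the center distance is \<open>r + s\<close>.\<close>

definition lorentz :: "lvec \<Rightarrow> lvec \<Rightarrow> real" where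
  "lorentz x y = mid x \<bullet> mid y - (cv x * cocv y + cv y * cocv x) / 2"

text \<open>A null vector satisfies \<open>cv x * cocv x = |mid x|^2\<close>, so both entries have
  the same sign and this condition selects one half of the light cone, apex included.\<close>

definition future :: "lvec \<Rightarrow> bool" where
  "future x \<longleftrightarrow> cv x \<ge> 0 \<and> cocv x \<ge> 0"

text \<open>A \<open>Codisk\<close> gets the negative of the vector of the complementary disk. The
  vector of a half-plane is the limit of those of disks of radius R around \<open>(t - R) e\<close>
  as R grows.\<close>

primrec disk_vec :: "gdisk \<Rightarrow> lvec" where
  "disk_vec (Disk c r) = (1 / r, c /\<^sub>R r, (c \<bullet> c - r\<^sup>2) / r)"
| "disk_vec (Codisk c r) = (- 1 / r, - (c /\<^sub>R r), (r\<^sup>2 - c \<bullet> c) / r)"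
| "disk_vec (Halfplane e t) = (0, - e, - 2 * t)"

definition vec_disk :: "lvec \<Rightarrow> gdisk" where
  "vec_disk x = (if cv x > 0 then Disk (mid x /\<^sub>R cv x) (1 / cv x)
     else if cv x < 0 then Codisk (mid x /\<^sub>R cv x) (- 1 / cv x)
     else Halfplane (- mid x) (- cocv x / 2))"

text \<open>The equation of the boundary circle: the classical power of the point \<open>z\<close>
  divided by the signed radius.\<close>

definition cpower :: "lvec \<Rightarrow> complex \<Rightarrow> real" where
  "cpower x z = cv x * (z \<bullet> z) - 2 * (mid x \<bullet> z) + cocv x"

text \<open>Half the gradient of \<open>cpower x\<close> at \<open>z\<close>; on the boundary this
  is the outward unit normal.\<close>

definition cnormal :: "lvec \<Rightarrow> complex \<Rightarrow> complex" where
  "cnormal x z = cv x *\<^sub>R z - mid x"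

lemma lorentz_commute: "lorentz x y = lorentz y x"
  by (simp add: lorentz_def inner_commute)

lemma lorentz_add_left: "lorentz (x + y) z = lorentz x z + lorentz y z"
  by (simp add: lorentz_def inner_add_left algebra_simps add_divide_distrib)

lemma lorentz_add_right: "lorentz z (x + y) = lorentz z x + lorentz z y"
  by (simp add: lorentz_commute[of z] lorentz_add_left)

lemma lorentz_scale_left: "lorentz (r *\<^sub>R x) y = r * lorentz x y"
  by (simp add: lorentz_def algebra_simps add_divide_distrib)

lemma lorentz_scale_right: "lorentz y (r *\<^sub>R x) = r * lorentz y x"
  by (simp add: lorentz_commute[of y] lorentz_scale_left)

lemma lorentz_minus_left: "lorentz (- x) y = - lorentz x y"
  using lorentz_scale_left[of "-1" x y] by simp

lemma lorentz_minus_right: "lorentz y (- x) = - lorentz y x"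
  using lorentz_scale_right[of y "-1" x] by simp

lemma lorentz_diff_left: "lorentz (x - y) z = lorentz x z - lorentz y z"
  using lorentz_add_left[of x "- y" z] by (simp add: lorentz_minus_left)

lemma lorentz_diff_right: "lorentz z (x - y) = lorentz z x - lorentz z y"
  by (simp add: lorentz_commute[of z] lorentz_diff_left)

lemma lorentz_zero_left [simp]: "lorentz 0 y = 0"
  by (simp add: lorentz_def)

lemma lorentz_zero_right [simp]: "lorentz y 0 = 0"
  by (simp add: lorentz_def)

lemma lorentz_sum_left: "lorentz (sum g A) y = (\<Sum>i\<in>A. lorentz (g i) y)"
  by (induction A rule: infinite_finite_induct) (auto simp: lorentz_add_left)

lemma lorentz_sum_right: "lorentz y (sum g A) = (\<Sum>i\<in>A. lorentz y (g i))"
  by (simp add: lorentz_commute[of y] lorentz_sum_left)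

lemmas lorentz_simps = lorentz_add_left lorentz_add_right lorentz_scale_left lorentz_scale_right
  lorentz_minus_left lorentz_minus_right lorentz_diff_left lorentz_diff_right

lemma lorentz_disk_vec: "valid_disk X \<Longrightarrow> lorentz (disk_vec X) (disk_vec X) = 1"
proof (cases X)
  case (Halfplane e t)
  moreover assume "valid_disk X"
  ultimately show ?thesis by (simp add: lorentz_def dot_square_norm)
qed (auto simp: lorentz_def field_simps power2_eq_square)

lemma cv_disk_vec: "cv (disk_vec X) = curvature X"
  by (cases X) auto

lemma vec_disk_disk_vec: "valid_disk X \<Longrightarrow> vec_disk (disk_vec X) = X"
  by (cases X) (auto simp: vec_disk_def field_simps)

lemma
  assumes "lorentz x x = 1"
  shows valid_vec_disk: "valid_disk (vec_disk x)"
    and disk_vec_vec_disk: "disk_vec (vec_disk x) = x"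
proof -
  obtain b \<beta> c where x: "x = (b, \<beta>, c)" by (cases x)
  have eq: "\<beta> \<bullet> \<beta> = 1 + b * c"
    using assms by (simp add: lorentz_def x)
  have "norm \<beta> = 1" if "b = 0"
    using eq that by (simp add: norm_eq_1)
  then show "valid_disk (vec_disk x)"
    by (auto simp: vec_disk_def x)
  show "disk_vec (vec_disk x) = x"
    using eq by (auto simp: vec_disk_def x field_simps power2_eq_square)
qed

section \<open>Powers of points as defining functions of regions\<close>

lemma cpower_add: "cpower (x + y) z = cpower x z + cpower y z"
  by (simp add: cpower_def inner_add_left algebra_simps)

lemma cpower_shift:
  "cpower x (p + h) = cpower x p + 2 * (cnormal x p \<bullet> h) + cv x * (h \<bullet> h)"
  by (simp add: cpower_def cnormal_def inner_add_left inner_add_right inner_diff_left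
      inner_commute algebra_simps)

lemma norm_cnormal:
  assumes "lorentz x x = 1" "cpower x p = 0"
  shows "cnormal x p \<bullet> cnormal x p = 1"
proof -
  have "cnormal x p \<bullet> cnormal x p = cv x * cpower x p + lorentz x x"
    by (simp add: cnormal_def cpower_def lorentz_def inner_diff_left inner_diff_right
      inner_commute algebra_simps)
  then show ?thesis using assms by simp
qed

text \<open>At a common boundary point the Lorentz product is the cosine of the angle between the
  outward normals. The correction terms in the identity contain the two powers and vanish
  there.\<close>

lemma lorentz_eq_inner_cnormal:
  assumes "cpower x p = 0" "cpower y p = 0"
  shows "lorentz x y = cnormal x p \<bullet> cnormal y p"
proof -
  have "cnormal x p \<bullet> cnormal y p = lorentz x y + (cv x * cpower y p + cv y * cpower x p) / 2"
    by (simp add: cnormal_def cpower_def lorentz_def inner_diff_left inner_diff_right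
      inner_commute algebra_simps add_divide_distrib diff_divide_distrib)
  then show ?thesis using assms by simp
qed

lemma cpower_disk_vec:
  assumes "valid_disk X"
  shows "cpower (disk_vec X) z = (case X of
     Disk c r \<Rightarrow> ((dist c z)\<^sup>2 - r\<^sup>2) / r
   | Codisk c r \<Rightarrow> (r\<^sup>2 - (dist c z)\<^sup>2) / r
   | Halfplane e t \<Rightarrow> 2 * (e \<bullet> z - t))"
  using assms
  by (cases X) (auto simp: cpower_def dist_norm power2_norm_eq_inner inner_diff_left
      inner_diff_right inner_commute field_simps)

lemma square_le_iff:
  fixes s t :: real
  assumes "0 \<le> s" "0 < t"
  shows "s\<^sup>2 \<le> t\<^sup>2 \<longleftrightarrow> s \<le> t" "t\<^sup>2 \<le> s\<^sup>2 \<longleftrightarrow> t \<le> s"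
    and "s\<^sup>2 < t\<^sup>2 \<longleftrightarrow> s < t" "t\<^sup>2 < s\<^sup>2 \<longleftrightarrow> t < s"
  using assms by (auto simp: power_mono_iff simp flip: not_le)

lemma region_eq_cpower:
  assumes "valid_disk X"
  shows "region X = {z. cpower (disk_vec X) z \<le> 0}"
  unfolding cpower_disk_vec[OF assms]
  using assms by (cases X) (auto simp: divide_le_0_iff square_le_iff not_less)

lemma interior_region_eq_cpower:
  assumes "valid_disk X"
  shows "interior (region X) = {z. cpower (disk_vec X) z < 0}"
proof (cases X)
  case (Halfplane e t)
  then have "e \<noteq> 0" using assms by auto
  then show ?thesis
    using assms Halfplane unfolding cpower_disk_vec[OF assms] by (auto simp: interior_halfspace_le)
next
  case (Disk c r)
  then show ?thesis
    using assms unfolding cpower_disk_vec[OF assms]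
    by (auto simp: divide_less_0_iff square_le_iff)
next
  case (Codisk c r)
  then show ?thesis
    using assms unfolding cpower_disk_vec[OF assms]
    by (auto simp: divide_less_0_iff interior_complement square_le_iff not_le)
qed

section \<open>Tangency of regions and Lorentz products\<close>

lemma cpower_eventually_neg:
  assumes "cpower x p \<le> 0" and "cpower x p = 0 \<Longrightarrow> cnormal x p \<bullet> d < 0"
  shows "\<forall>\<^sub>F \<epsilon> in at_right 0. cpower x (p + \<epsilon> *\<^sub>R d) < 0"
proof (cases "cpower x p = 0")
  case True
  have "((\<lambda>\<epsilon>. 2 * (cnormal x p \<bullet> d) + \<epsilon> * (cv x * (d \<bullet> d))) \<longlongrightarrow>
      2 * (cnormal x p \<bullet> d) + 0 * (cv x * (d \<bullet> d))) (at_right 0)"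
    by (intro tendsto_intros)
  moreover have "2 * (cnormal x p \<bullet> d) + 0 * (cv x * (d \<bullet> d)) < 0"
    using assms(2) True by simp
  ultimately have "\<forall>\<^sub>F \<epsilon> in at_right 0. 2 * (cnormal x p \<bullet> d) + \<epsilon> * (cv x * (d \<bullet> d)) < 0"
    by (rule order_tendstoD)
  moreover have "\<forall>\<^sub>F \<epsilon> in at_right (0::real). \<epsilon> > 0"
    by (simp add: eventually_at_right_less)
  ultimately show ?thesis
  proof eventually_elim
    case (elim \<epsilon>)
    have "cpower x (p + \<epsilon> *\<^sub>R d) = \<epsilon> * (2 * (cnormal x p \<bullet> d) + \<epsilon> * (cv x * (d \<bullet> d)))"
      using True by (simp add: cpower_shift algebra_simps)
    then show ?case
      using elim by (simp add: mult_less_0_iff)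
  qed
next
  case False
  have "((\<lambda>\<epsilon>. cpower x p + 2 * (\<epsilon> * (cnormal x p \<bullet> d)) + cv x * (\<epsilon> * (\<epsilon> * (d \<bullet> d)))) \<longlongrightarrow>
      cpower x p + 2 * (0 * (cnormal x p \<bullet> d)) + cv x * (0 * (0 * (d \<bullet> d)))) (at_right 0)"
    by (intro tendsto_intros)
  moreover have "cpower x p + 2 * (0 * (cnormal x p \<bullet> d)) + cv x * (0 * (0 * (d \<bullet> d))) < 0"
    using False assms(1) by simp
  ultimately show ?thesis
    unfolding cpower_shift by (auto dest: order_tendstoD)
qed

text \<open>A direction pointing into both regions at \<open>p\<close> would lead to a common
  interior point. Hence \<open>p\<close> lies on both boundaries and the outward normals are
  opposite. That the regions meet only in \<open>p\<close> then gives the sign of the summed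
  curvature.\<close>

lemma tangent_at_point:
  assumes X: "valid_disk X" and Y: "valid_disk Y"
    and disj: "interior (region X) \<inter> interior (region Y) = {}"
    and p: "region X \<inter> region Y = {p}"
  defines "x \<equiv> disk_vec X" and "y \<equiv> disk_vec Y"
  shows "lorentz x y = -1" "cv (x + y) > 0" "mid (x + y) = cv (x + y) *\<^sub>R p" "future (x + y)"
proof -
  have lx: "lorentz x x = 1" and ly: "lorentz y y = 1"
    using X Y by (auto simp: x_def y_def lorentz_disk_vec)
  have reg: "region X = {z. cpower x z \<le> 0}" "region Y = {z. cpower y z \<le> 0}"
    using X Y by (auto simp: x_def y_def region_eq_cpower)
  have no_common: "\<not> (cpower x z < 0 \<and> cpower y z < 0)" for z
    using disj X Y by (auto simp: x_def y_def interior_region_eq_cpower)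
  have no_dir: "\<not> ((cpower x p = 0 \<longrightarrow> cnormal x p \<bullet> d < 0) \<and>
      (cpower y p = 0 \<longrightarrow> cnormal y p \<bullet> d < 0))" for d
  proof
    assume *: "(cpower x p = 0 \<longrightarrow> cnormal x p \<bullet> d < 0) \<and>
      (cpower y p = 0 \<longrightarrow> cnormal y p \<bullet> d < 0)"
    have "cpower x p \<le> 0" "cpower y p \<le> 0" using p reg by auto
    with * have "\<forall>\<^sub>F \<epsilon> in at_right 0. cpower x (p + \<epsilon> *\<^sub>R d) < 0 \<and> cpower y (p + \<epsilon> *\<^sub>R d) < 0"
      by (intro eventually_conj cpower_eventually_neg) auto
    then have "\<forall>\<^sub>F \<epsilon> in at_right (0::real). False"
      by eventually_elim (use no_common in blast)
    then show False by simp
  qed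
  \<comment> \<open>If \<open>p\<close> were interior to \<open>X\<close>, stepping from
    \<open>p\<close> against the normal of \<open>Y\<close> would enter both interiors.\<close>
  have px: "cpower x p = 0"
  proof (rule ccontr)
    assume "cpower x p \<noteq> 0"
    then have "\<not> (cpower y p = 0 \<longrightarrow> cnormal y p \<bullet> (- cnormal y p) < 0)"
      using no_dir by blast
    then show False using norm_cnormal[OF ly, of p] by auto
  qed
  have py: "cpower y p = 0"
  proof (rule ccontr)
    assume "cpower y p \<noteq> 0"
    then have "\<not> (cpower x p = 0 \<longrightarrow> cnormal x p \<bullet> (- cnormal x p) < 0)"
      using no_dir by blast
    then show False using norm_cnormal[OF lx, of p] by auto
  qed
  define e where "e = cnormal x p"
  define e' where "e' = cnormal y p"
  have e: "e \<bullet> e = 1" "e' \<bullet> e' = 1"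
    using norm_cnormal lx ly px py by (auto simp: e_def e'_def)
  have opp: "e' = - e"
  proof (rule ccontr)
    assume "e' \<noteq> - e"
    \<comment> \<open>For unit vectors that are not opposite, \<open>- (e + e')\<close> has negative
      product with both of them, so it is a forbidden direction.\<close>
    then have "(e + e') \<bullet> (e + e') > 0"
      by (metis eq_neg_iff_add_eq_0 add.commute inner_gt_zero_iff)
    then have "e \<bullet> e' > -1"
      using e by (simp add: inner_add_left inner_add_right inner_commute)
    then have "e \<bullet> (- (e + e')) < 0 \<and> e' \<bullet> (- (e + e')) < 0"
      using e by (simp add: inner_diff_right inner_commute)
    then show False using no_dir[of "- (e + e')"] by (auto simp: e_def e'_def)
  qed
  show "lorentz x y = -1"
    using lorentz_eq_inner_cnormal[OF px py] opp e by (simp add: e_def e'_def)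
  show mid: "mid (x + y) = cv (x + y) *\<^sub>R p"
    using opp by (simp add: e_def e'_def cnormal_def algebra_simps)
  show pos: "cv (x + y) > 0"
  proof (rule ccontr)
    assume "\<not> cv (x + y) > 0"
    then have le: "cv x + cv y \<le> 0" by simp
    \<comment> \<open>\<open>p + h\<close> is a second point of the boundary circle of \<open>X\<close>: the inversion \<open>h \<mapsto> h / |h|\<^sup>2\<close>
      turns that circle into a line.\<close>
    define k where "k = (- cv x / 2) *\<^sub>R e + \<i> * e"
    define h where "h = k /\<^sub>R (k \<bullet> k)"
    have ie: "e \<bullet> (\<i> * e) = 0" by (simp add: inner_complex_def)
    have ek: "e \<bullet> k = - cv x / 2" using ie e unfolding k_def inner_add_right by simp
    have "e \<noteq> 0" using e by auto
    have "k = (- cv x / 2 + \<i>) * e" by (simp add: k_def algebra_simps scaleR_conv_of_real)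
    moreover have "- cv x / 2 + \<i> \<noteq> 0" by (simp add: complex_eq_iff)
    ultimately have "k \<noteq> 0" using \<open>e \<noteq> 0\<close> by simp
    then have hh: "h \<bullet> h = 1 / (k \<bullet> k)" and "h \<noteq> 0" by (auto simp: h_def field_simps)
    have eh: "e \<bullet> h = (- cv x / 2) * (h \<bullet> h)" unfolding hh by (simp add: h_def ek inverse_eq_divide)
    have "cpower x (p + h) \<le> 0"
      using eh by (simp add: cpower_shift px flip: e_def)
    moreover have "cpower y (p + h) = (cv x + cv y) * (h \<bullet> h)"
      using eh opp unfolding cpower_shift e'_def[symmetric] py by (simp add: algebra_simps)
    then have "cpower y (p + h) \<le> 0" using le by (simp add: mult_nonpos_nonneg)
    ultimately have "p + h \<in> region X \<inter> region Y" by (simp add: reg)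
    then show False using p \<open>h \<noteq> 0\<close> by auto
  qed
  have "cpower (x + y) p = 0" by (simp add: cpower_add px py)
  then have "cocv (x + y) = cv (x + y) * (p \<bullet> p)"
    unfolding cpower_def mid by simp
  then show "future (x + y)"
    using pos by (simp add: future_def)
qed

lemma tangent_disk_vec:
  assumes "tangent X Y"
  shows "lorentz (disk_vec X) (disk_vec Y) = -1" "future (disk_vec X + disk_vec Y)"
proof -
  have v: "valid_disk X" "valid_disk Y" "interior (region X) \<inter> interior (region Y) = {}"
    using assms by (auto simp: tangent_def)
  have "lorentz (disk_vec X) (disk_vec Y) = -1 \<and> future (disk_vec X + disk_vec Y)"
  proof (cases "\<exists>p. region X \<inter> region Y = {p}")
    case True
    then show ?thesis using tangent_at_point v by blast
  next
    case False
    then obtain e s t where XY: "X = Halfplane e s" "Y = Halfplane (- e) t"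
      using assms by (auto simp: tangent_def)
    have e: "e \<bullet> e = 1" using v XY by (simp add: norm_eq_1)
    have "s + t \<le> 0"
    proof (rule ccontr)
      assume "\<not> s + t \<le> 0"
      \<comment> \<open>The midpoint of the strip in which the two half-planes would
        overlap.\<close>
      then have "((s - t) / 2) *\<^sub>R e \<in> interior (region X) \<inter> interior (region Y)"
        using e unfolding interior_region_eq_cpower[OF v(1)] interior_region_eq_cpower[OF v(2)]
          cpower_disk_vec[OF v(1)] cpower_disk_vec[OF v(2)] by (simp add: XY field_simps)
      then show False using v by auto
    qed
    then show ?thesis using e by (simp add: XY lorentz_def future_def)
  qed
  then show "lorentz (disk_vec X) (disk_vec Y) = -1" "future (disk_vec X + disk_vec Y)"
    by auto
qed

text \<open>The null vector \<open>x + y\<close> encodes the contact point: if its curvature is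
  positive, its power at \<open>z\<close> is a positive multiple of \<open>|z - p|^2\<close>, so
  both powers can be nonpositive only at \<open>p\<close>. If its curvature is zero, contact is at
  infinity. The condition \<open>nz\<close> excludes complementary regions, whose vectors are
  opposite.\<close>

lemma tangentI:
  assumes X: "valid_disk X" and Y: "valid_disk Y"
  defines "x \<equiv> disk_vec X" and "y \<equiv> disk_vec Y"
  assumes l: "lorentz x y = -1" and fut: "future (x + y)" and nz: "x + y \<noteq> 0"
  shows "tangent X Y"
proof -
  define n where "n = x + y"
  have lx: "lorentz x x = 1" and ly: "lorentz y y = 1"
    using X Y by (auto simp: x_def y_def lorentz_disk_vec)
  have null: "lorentz n n = 0" and xn: "lorentz x n = 0" and yn: "lorentz y n = 0"
    using lx ly l by (auto simp: n_def lorentz_simps lorentz_commute)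
  have reg: "region X = {z. cpower x z \<le> 0}" "region Y = {z. cpower y z \<le> 0}"
    and int: "interior (region X) = {z. cpower x z < 0}" "interior (region Y) = {z. cpower y z < 0}"
    using X Y by (simp_all add: x_def y_def region_eq_cpower flip: interior_region_eq_cpower)
  have sum: "cpower n z = cpower x z + cpower y z" for z
    by (simp add: n_def cpower_add)
  have nn: "mid n \<bullet> mid n = cv n * cocv n" using null by (simp add: lorentz_def)
  show ?thesis
  proof (cases "cv n = 0")
    case False
    then have pos: "cv n > 0" using fut by (simp add: future_def n_def)
    define p where "p = mid n /\<^sub>R cv n"
    have power_n: "cpower n z = cv n * ((z - p) \<bullet> (z - p))" for z
      using pos nn by (simp add: cpower_def p_def inner_diff_left inner_diff_right
          inner_commute field_simps)
    \<comment> \<open>Being orthogonal to \<open>n\<close> means that the circle of \<open>w\<close>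
      passes through \<open>p\<close>.\<close>
    have vanish: "cpower w p = 0" if "lorentz w n = 0" for w
    proof -
      have "cv n * cpower w p = - 2 * lorentz w n"
        using pos nn by (simp add: cpower_def p_def lorentz_def field_simps)
      then show ?thesis using that pos by simp
    qed
    have "cpower x z + cpower y z \<ge> 0" for z
      using pos power_n[of z] unfolding sum by simp
    then have "\<not> (cpower x z < 0 \<and> cpower y z < 0)" for z
      by (meson add_neg_neg not_less)
    then have "interior (region X) \<inter> interior (region Y) = {}"
      unfolding int by blast
    moreover have "region X \<inter> region Y = {p}"
    proof -
      have "z = p" if "cpower x z \<le> 0" "cpower y z \<le> 0" for z
      proof -
        have "cpower n z \<le> 0" using that by (simp add: sum)
        then have "(z - p) \<bullet> (z - p) \<le> 0" using pos by (simp add: power_n mult_le_0_iff)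
        then show ?thesis by (metis inner_ge_zero inner_eq_zero_iff antisym right_minus_eq)
      qed
      then show ?thesis using vanish[OF xn] vanish[OF yn] by (auto simp: reg)
    qed
    ultimately show ?thesis using X Y by (auto simp: tangent_def)
  next
    case True
    then have "mid n = 0" using nn by simp
    have "cocv n > 0"
      using True \<open>mid n = 0\<close> nz fut unfolding future_def n_def[symmetric]
      by (metis order_le_less prod_eqI fst_zero snd_zero)
    \<comment> \<open>Only the co-curvature of \<open>n\<close> survives, so the products with
      \<open>n\<close> are \<open>- cv x * cocv n / 2\<close> and
      \<open>- cv y * cocv n / 2\<close>.\<close>
    have "cv x = 0" "cv y = 0"
      using xn yn True \<open>mid n = 0\<close> \<open>cocv n > 0\<close> by (auto simp: lorentz_def)
    then obtain e s e' t where XY: "X = Halfplane e s" "Y = Halfplane e' t"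
      using X Y unfolding x_def y_def by (cases X; cases Y) auto
    have "e' = - e" using \<open>mid n = 0\<close> by (simp add: n_def x_def y_def XY)
    have "cpower x z + cpower y z > 0" for z
      using \<open>mid n = 0\<close> \<open>cocv n > 0\<close> True unfolding sum[symmetric] cpower_def[of n] by simp
    then have "\<not> (cpower x z < 0 \<and> cpower y z < 0)" for z
      by (meson add_neg_neg less_asym)
    then have "interior (region X) \<inter> interior (region Y) = {}"
      unfolding int by blast
    then show ?thesis using X Y XY \<open>e' = - e\<close> by (auto simp: tangent_def)
  qed
qed

section \<open>Spinors in inversive coordinates\<close>

lemma outward_normal_eq_cnormal:
  "valid_disk X \<Longrightarrow> outward_normal X p = cnormal (disk_vec X) p"
  by (cases X) (auto simp: cnormal_def scaleR_conv_of_real field_simps)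

lemma mid_disk_vec: "center X = Some c \<Longrightarrow> mid (disk_vec X) = curvature X *\<^sub>R c"
  by (cases X) (auto simp: divide_inverse)

text \<open>One formula covers all cases of the definition. When exactly one disk is a half-plane,
  the contact point is eliminated by \<open>mid x + mid y = (cv x + cv y) p\<close>; for two
  half-planes both sides vanish.\<close>

lemma tangency_spinor_square:
  assumes "tangency_spinor X Y u"
  shows "u\<^sup>2 = cv (disk_vec X) *\<^sub>R mid (disk_vec Y) - cv (disk_vec Y) *\<^sub>R mid (disk_vec X)"
proof -
  have t: "tangent X Y" using assms by (simp add: tangency_spinor_def)
  have contact: ?thesis if p: "region X \<inter> region Y = {p}"
    and u: "u\<^sup>2 = of_real (curvature X + curvature Y) * outward_normal X p" for p
  proof -
    let ?x = "disk_vec X" and ?y = "disk_vec Y"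
    have X: "valid_disk X" using t by (simp add: tangent_def)
    have mid: "mid ?x + mid ?y = (cv ?x + cv ?y) *\<^sub>R p"
      using tangent_at_point(3)[of X Y p] t p by (simp add: tangent_def)
    have "u\<^sup>2 = (cv ?x + cv ?y) *\<^sub>R (cv ?x *\<^sub>R p - mid ?x)"
      using u X by (simp add: outward_normal_eq_cnormal cnormal_def cv_disk_vec scaleR_conv_of_real)
    also have "\<dots> = cv ?x *\<^sub>R ((cv ?x + cv ?y) *\<^sub>R p) - (cv ?x + cv ?y) *\<^sub>R mid ?x"
      by (simp add: scaleR_conv_of_real algebra_simps)
    also have "\<dots> = cv ?x *\<^sub>R mid ?y - cv ?y *\<^sub>R mid ?x"
      unfolding mid[symmetric] by (simp add: scaleR_conv_of_real algebra_simps)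
    finally show ?thesis .
  qed
  show ?thesis
  proof (cases "center X")
    case None
    show ?thesis
    proof (cases "center Y")
      case None
      with \<open>center X = None\<close> have "cv (disk_vec X) = 0" "cv (disk_vec Y) = 0" "u = 0"
        using assms by (auto simp: tangency_spinor_def) (cases X; cases Y; auto)+
      then show ?thesis by simp
    next
      case (Some c)
      then show ?thesis using None assms contact by (auto simp: tangency_spinor_def)
    qed
  next
    case X: (Some c)
    show ?thesis
    proof (cases "center Y")
      case None
      then show ?thesis using X assms contact by (auto simp: tangency_spinor_def)
    next
      case (Some c')
      then show ?thesis using X assms
        by (auto simp: tangency_spinor_def mid_disk_vec cv_disk_vec scaleR_conv_of_real algebra_simps)
    qed
  qed
qed

section \<open>Descartes quadruples\<close>

text \<open>Cauchy-Schwarz bounds the inner product of the \<open>mid\<close> parts by a geometric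
  mean, and the arithmetic mean dominates that.\<close>

lemma lorentz_future_le:
  assumes "lorentz x x = 0" "lorentz y y = 0" "future x" "future y"
  shows "lorentz x y \<le> 0"
proof -
  let ?s = "cv x * cocv y" and ?t = "cv y * cocv x"
  have nn: "?s \<ge> 0" "?t \<ge> 0" using assms by (auto simp: future_def)
  have "(mid x \<bullet> mid y)\<^sup>2 \<le> (mid x \<bullet> mid x) * (mid y \<bullet> mid y)"
    by (rule Cauchy_Schwarz_ineq)
  also have "\<dots> = ?s * ?t" using assms by (simp add: lorentz_def)
  also have "\<dots> \<le> ((?s + ?t) / 2)\<^sup>2"
    using zero_le_power2[of "?s - ?t"] by (simp add: power2_eq_square field_simps)
  finally have "mid x \<bullet> mid y \<le> (?s + ?t) / 2"
    by (rule power2_le_imp_le) (use nn in simp)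
  then show ?thesis by (simp add: lorentz_def)
qed

text \<open>A null vector or its negative is future, and a future \<open>- y\<close> would reverse
  the sign of the product.\<close>

lemma future_if_lorentz_neg:
  assumes "lorentz x x = 0" "lorentz y y = 0" "future x" "lorentz x y < 0"
  shows "future y"
proof (rule ccontr)
  assume "\<not> future y"
  moreover have "cv y * cocv y \<ge> 0"
    using assms(2) inner_ge_zero[of "mid y"] by (simp add: lorentz_def)
  ultimately have "future (- y)"
    by (auto simp: future_def zero_le_mult_iff)
  then have "lorentz x (- y) \<le> 0"
    using assms by (intro lorentz_future_le) (auto simp: lorentz_simps)
  then show False using assms by (simp add: lorentz_simps)
qed

text \<open>The form has a single negative direction, which \<open>s\<close> uses up. Concretely, if
  \<open>n\<close> were not spacelike, the mean inequality and Cauchy-Schwarz would bound the same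
  square from both sides and force \<open>n = 0\<close>.\<close>

lemma lorentz_pos_if_orthogonal_timelike:
  assumes s: "lorentz s s < 0" and ns: "lorentz n s = 0" and "n \<noteq> 0"
  shows "lorentz n n > 0"
proof (rule ccontr)
  assume "\<not> lorentz n n > 0"
  then have le: "mid n \<bullet> mid n \<le> cv n * cocv n" by (simp add: lorentz_def)
  have lt: "mid s \<bullet> mid s < cv s * cocv s" using s by (simp add: lorentz_def)
  have eq: "mid n \<bullet> mid s = (cv n * cocv s + cv s * cocv n) / 2"
    using ns by (simp add: lorentz_def)
  let ?p = "cv n * cocv n" and ?q = "cv s * cocv s"
  have p: "?p \<ge> 0" using le inner_ge_zero[of "mid n"] by linarith
  have q: "?q > 0" using lt inner_ge_zero[of "mid s"] by linarith
  have "?p * ?q \<le> (mid n \<bullet> mid s)\<^sup>2"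
    unfolding eq using zero_le_power2[of "cv n * cocv s - cv s * cocv n"]
    by (simp add: power2_eq_square field_simps)
  also have "\<dots> \<le> (mid n \<bullet> mid n) * (mid s \<bullet> mid s)"
    by (rule Cauchy_Schwarz_ineq)
  also have "\<dots> \<le> ?p * (mid s \<bullet> mid s)"
    using le by (simp add: mult_right_mono)
  finally have "?p * (?q - mid s \<bullet> mid s) \<le> 0" by (simp add: algebra_simps)
  then have "?p = 0"
    using p lt mult_pos_pos[of ?p "?q - mid s \<bullet> mid s"] by argo
  then have "mid n = 0" using le inner_ge_zero[of "mid n"] by (metis order_antisym inner_eq_zero_iff)
  then have "cv n * cocv s = - (cv s * cocv n)" using eq by simp
  moreover have "cv s \<noteq> 0" "cocv s \<noteq> 0" using q by auto
  ultimately have "cv n = 0 \<and> cocv n = 0" using \<open>?p = 0\<close> by auto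
  then show False using \<open>mid n = 0\<close> \<open>n \<noteq> 0\<close> by (metis prod_eqI fst_zero snd_zero)
qed

section \<open>Quadruples with Gram matrix 2I - J and their exchanges\<close>

definition descartes :: "(4 \<Rightarrow> lvec) \<Rightarrow> bool" where
  "descartes Q \<longleftrightarrow> (\<forall>i j. lorentz (Q i) (Q j) = (if i = j then 1 else -1)) \<and>
     (\<forall>i j. i \<noteq> j \<longrightarrow> future (Q i + Q j))"

text \<open>Twice the sum of the other three vectors minus \<open>Q j\<close>, written with the full
  sum, hence the coefficient 3. The other disks keep their positions.\<close>

definition flip :: "4 \<Rightarrow> (4 \<Rightarrow> lvec) \<Rightarrow> 4 \<Rightarrow> lvec" where
  "flip j Q = Q(j := 2 *\<^sub>R (\<Sum>i\<in>UNIV. Q i) - 3 *\<^sub>R Q j)"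

lemma ex_index_not_in: "\<exists>l :: 4. l \<noteq> i \<and> l \<noteq> j \<and> l \<noteq> k"
proof (rule ccontr)
  assume "\<not> ?thesis"
  then have "(UNIV :: 4 set) \<subseteq> {i, j, k}" by auto
  then have "card (UNIV :: 4 set) \<le> card {i, j, k}" by (rule card_mono[rotated]) simp
  also have "\<dots> \<le> 3" by (simp add: card_insert_if)
  finally show False by simp
qed

lemma sum_delta_4:
  fixes c d :: real
  shows "(\<Sum>k\<in>(UNIV :: 4 set). if k = i then c else d) = c + 3 * d"
proof -
  have "(\<Sum>k\<in>(UNIV :: 4 set). if k = i then c else d) = (\<Sum>k\<in>(UNIV :: 4 set). (if k = i then c - d else 0) + d)"
    by (intro sum.cong) auto
  then show ?thesis by (simp add: sum.distrib)
qed

lemma sum_flip: "(\<Sum>i\<in>UNIV. flip j Q i) = 3 *\<^sub>R (\<Sum>i\<in>UNIV. Q i) - 4 *\<^sub>R Q j"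
proof -
  let ?S = "\<Sum>i\<in>UNIV. Q i" and ?R = "\<Sum>i\<in>UNIV - {j}. Q i"
  have "(\<Sum>i\<in>UNIV. flip j Q i) = (2 *\<^sub>R ?S - 3 *\<^sub>R Q j) + ?R"
    by (subst sum.remove[of _ j]) (auto simp: flip_def intro!: sum.cong)
  moreover have "?S = Q j + ?R"
    by (subst sum.remove[of _ j]) auto
  ultimately have "(\<Sum>i\<in>UNIV. flip j Q i) = (2 *\<^sub>R ?S - 3 *\<^sub>R Q j) + (?S - Q j)"
    by simp
  also have "\<dots> = 3 *\<^sub>R ?S - 4 *\<^sub>R Q j"
    by (simp only: prod_eq_iff complex_eq_iff) simp
  finally show ?thesis .
qed

lemma flip_flip [simp]: "flip j (flip j Q) = Q"
proof
  fix i
  let ?S = "\<Sum>i\<in>UNIV. Q i"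
  show "flip j (flip j Q) i = Q i"
  proof (cases "i = j")
    case True
    have "flip j (flip j Q) j = 2 *\<^sub>R (3 *\<^sub>R ?S - 4 *\<^sub>R Q j) - 3 *\<^sub>R (2 *\<^sub>R ?S - 3 *\<^sub>R Q j)"
      unfolding sum_flip[symmetric] by (simp add: flip_def)
    also have "\<dots> = Q j"
      by (simp only: prod_eq_iff complex_eq_iff) simp
    finally show ?thesis using True by simp
  qed (simp add: flip_def)
qed

lemma flip_other [simp]: "i \<noteq> j \<Longrightarrow> flip j Q i = Q i"
  by (simp add: flip_def)

lemma lorentz_descartes_sum:
  assumes "descartes Q"
  shows "lorentz (Q i) (\<Sum>k\<in>UNIV. Q k) = -2"
  using assms by (simp add: descartes_def lorentz_sum_right eq_commute[of i] sum_delta_4)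

text \<open>The Gram matrix follows from the products -2 and -8 of the total sum with each member
  and with itself. For the time orientation, the null vectors \<open>Q i + Q k\<close> and
  \<open>Q i + flip j Q j\<close> have product -2, so the second inherits being future from the
  first.\<close>

lemma descartes_flip:
  assumes "descartes Q"
  shows "descartes (flip j Q)"
proof -
  have gram: "lorentz (Q i) (Q k) = (if i = k then 1 else -1)" for i k
    using assms by (simp add: descartes_def)
  have fut: "future (Q i + Q k)" if "i \<noteq> k" for i k
    using assms that by (simp add: descartes_def)
  let ?S = "\<Sum>k\<in>UNIV. Q k"
  have S: "lorentz (Q i) ?S = -2" "lorentz ?S (Q i) = -2" for i
    using lorentz_descartes_sum[OF assms] by (auto simp: lorentz_commute)
  have SS: "lorentz ?S ?S = -8"
    by (subst lorentz_sum_left) (simp add: S)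
  have j: "flip j Q j = 2 *\<^sub>R ?S - 3 *\<^sub>R Q j" by (simp add: flip_def)
  have gram': "lorentz (flip j Q i) (flip j Q k) = (if i = k then 1 else -1)" for i k
    by (cases "i = j"; cases "k = j") (auto simp: j lorentz_simps S SS gram)
  have fut_j: "future (Q i + flip j Q j)" if i: "i \<noteq> j" for i
  proof -
    obtain k where k: "k \<noteq> i" "k \<noteq> j"
      using ex_index_not_in[of i j j] by auto
    have g: "lorentz (Q i) (flip j Q j) = -1" "lorentz (Q k) (flip j Q j) = -1"
      "lorentz (flip j Q j) (flip j Q j) = 1"
      "lorentz (flip j Q j) (Q i) = -1" "lorentz (flip j Q j) (Q k) = -1"
      using gram'[of i j] gram'[of k j] gram'[of j j] gram'[of j i] gram'[of j k] i k by auto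
    show ?thesis
      by (rule future_if_lorentz_neg[of "Q i + Q k"])
        (use i k g fut gram in \<open>auto simp: lorentz_simps\<close>)
  qed
  have "future (flip j Q i + flip j Q k)" if "i \<noteq> k" for i k
    using that fut fut_j[of i] fut_j[of k] by (cases "i = j"; cases "k = j") (auto simp: add.commute)
  then show ?thesis using gram' by (simp add: descartes_def)
qed

text \<open>The Gram matrix is invertible, so the four vectors span the whole four-dimensional space
  and \<open>y\<close> is orthogonal to everything.\<close>

lemma descartes_nondegenerate:
  assumes "descartes Q" and y: "\<And>i. lorentz y (Q i) = 0"
  shows "y = 0"
proof -
  have gram: "lorentz (Q i) (Q k) = (if i = k then 1 else -1)" for i k
    using assms by (simp add: descartes_def)
  have inj: "inj Q"
    by (rule injI) (metis gram one_neq_neg_one)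
  have "independent (range Q)"
  proof (rule independent_if_scalars_zero)
    fix f v assume z: "(\<Sum>x\<in>range Q. f x *\<^sub>R x) = 0" and v: "v \<in> range Q"
    have z: "(\<Sum>k\<in>UNIV. f (Q k) *\<^sub>R Q k) = 0"
      using z by (simp add: sum.reindex[OF inj])
    have eq: "2 * f (Q i) = (\<Sum>k\<in>UNIV. f (Q k))" for i
    proof -
      have "0 = lorentz (\<Sum>k\<in>UNIV. f (Q k) *\<^sub>R Q k) (Q i)" by (simp add: z)
      also have "\<dots> = (\<Sum>k\<in>UNIV. f (Q k) * (if k = i then 1 else -1))"
        by (simp add: lorentz_sum_left lorentz_scale_left gram)
      also have "\<dots> = (\<Sum>k\<in>UNIV. (if k = i then 2 * f (Q k) else 0) - f (Q k))"
        by (intro sum.cong) auto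
      finally show ?thesis by (simp add: sum_subtractf)
    qed
    \<comment> \<open>Summing the four equations says that twice the total equals four times the
      total, so the total and then each coefficient vanishes.\<close>
    have "(\<Sum>i\<in>(UNIV::4 set). 2 * f (Q i)) = 4 * (\<Sum>k\<in>UNIV. f (Q k))"
      by (simp add: eq)
    then have "(\<Sum>k\<in>UNIV. f (Q k)) = 0" by (simp flip: sum_distrib_left)
    then show "f v = 0" using eq v by auto
  qed simp
  moreover have "card (range Q) = DIM(lvec)" by (simp add: card_image inj)
  ultimately have "span (range Q) = UNIV"
    using card_eq_dim[of "range Q" UNIV] by auto
  have orth: "lorentz y z = 0" for z
  proof -
    have "z \<in> span (range Q)" using \<open>span (range Q) = UNIV\<close> by simp
    then show ?thesis
      by (induction rule: span_induct_alt) (auto simp: lorentz_simps y)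
  qed
  \<comment> \<open>These three test vectors detect \<open>mid y\<close>, \<open>cocv y\<close> and
    \<open>cv y\<close>.\<close>
  have "lorentz y (0, mid y, 0) = 0" "lorentz y (1, 0, 0) = 0" "lorentz y (0, 0, 1) = 0"
    by (rule orth)+
  then show ?thesis
    by (auto simp: lorentz_def prod_eq_iff)
qed

text \<open>Since J squares to 4J, the Gram matrix 2I - J squares to 4I. It is therefore its own
  inverse up to the factor 4, which gives the coefficients; pairing the expansion with
  \<open>y\<close> gives the quadratic relation.\<close>

lemma descartes_expansion:
  assumes Q: "descartes Q"
  defines "S \<equiv> \<lambda>y. \<Sum>k\<in>UNIV. lorentz y (Q k)"
  shows "4 *\<^sub>R y = (\<Sum>k\<in>UNIV. (2 * lorentz y (Q k) - S y) *\<^sub>R Q k)"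
    and "4 * lorentz y y = 2 * (\<Sum>k\<in>UNIV. (lorentz y (Q k))\<^sup>2) - (S y)\<^sup>2"
proof -
  have gram: "lorentz (Q i) (Q k) = (if i = k then 1 else -1)" for i k
    using assms by (simp add: descartes_def)
  let ?z = "\<Sum>k\<in>UNIV. (2 * lorentz y (Q k) - S y) *\<^sub>R Q k"
  have "4 *\<^sub>R y - ?z = 0"
  proof (rule descartes_nondegenerate[OF Q])
    fix i
    have "lorentz ?z (Q i) = (\<Sum>k\<in>UNIV. (2 * lorentz y (Q k) - S y) * (if k = i then 1 else -1))"
      by (simp add: lorentz_sum_left lorentz_scale_left gram)
    also have "\<dots> = (\<Sum>k\<in>UNIV. (if k = i then 2 * (2 * lorentz y (Q k) - S y) else 0)
        - 2 * lorentz y (Q k) + S y)"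
      by (intro sum.cong) auto
    also have "\<dots> = 2 * (2 * lorentz y (Q i) - S y) - 2 * S y + 4 * S y"
      by (simp add: sum.distrib sum_subtractf S_def flip: sum_distrib_left)
    finally show "lorentz (4 *\<^sub>R y - ?z) (Q i) = 0"
      by (simp add: lorentz_simps)
  qed
  then show eq: "4 *\<^sub>R y = ?z" by simp
  have "4 * lorentz y y = lorentz y (4 *\<^sub>R y)" by (simp add: lorentz_simps)
  also have "\<dots> = (\<Sum>k\<in>UNIV. (2 * lorentz y (Q k) - S y) * lorentz y (Q k))"
    unfolding eq by (simp add: lorentz_sum_right lorentz_scale_right)
  also have "\<dots> = 2 * (\<Sum>k\<in>UNIV. (lorentz y (Q k))\<^sup>2) - S y * S y"
    by (simp add: left_diff_distrib sum_subtractf power2_eq_square mult.assoc S_def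
        flip: sum_distrib_left)
  finally show "4 * lorentz y y = 2 * (\<Sum>k\<in>UNIV. (lorentz y (Q k))\<^sup>2) - (S y)\<^sup>2"
    by (simp add: power2_eq_square)
qed

text \<open>The only unknown is the product \<open>t\<close> with \<open>Q l\<close>. Norm 1 makes
  it a root of \<open>(t - 1) * (t + 7)\<close>, and the two roots belong to \<open>Q l\<close> and
  to its exchange.\<close>

lemma descartes_fourth:
  assumes Q: "descartes Q" and w: "lorentz w w = 1" and wQ: "\<And>i. i \<noteq> l \<Longrightarrow> lorentz w (Q i) = -1"
  shows "w = Q l \<or> w = flip l Q l"
proof -
  define t where "t = lorentz w (Q l)"
  have c: "lorentz w (Q k) = (if k = l then t else -1)" for k
    using wQ by (simp add: t_def)
  have S: "(\<Sum>k\<in>UNIV. lorentz w (Q k)) = t - 3"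
    by (simp add: c sum_delta_4)
  have S2: "(\<Sum>k\<in>UNIV. (lorentz w (Q k))\<^sup>2) = t\<^sup>2 + 3"
  proof -
    have "(\<Sum>k\<in>UNIV. (lorentz w (Q k))\<^sup>2) = (\<Sum>k\<in>UNIV. if k = l then t\<^sup>2 else 1)"
      by (intro sum.cong) (auto simp: c)
    then show ?thesis by (simp add: sum_delta_4)
  qed
  have "4 = 2 * (t\<^sup>2 + 3) - (t - 3)\<^sup>2"
    using descartes_expansion(2)[OF Q, of w] by (simp add: S S2 w)
  then have "(t - 1) * (t + 7) = 0" by (simp add: power2_eq_square algebra_simps)
  then consider "t = 1" | "t = -7" by auto
  then show ?thesis
  proof cases
    case 1
    have "4 *\<^sub>R w = (\<Sum>k\<in>UNIV. if k = l then 4 *\<^sub>R Q k else 0)"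
      unfolding descartes_expansion(1)[OF Q, of w] S by (intro sum.cong) (auto simp: c 1)
    then show ?thesis by simp
  next
    case 2
    have "4 *\<^sub>R w = (\<Sum>k\<in>UNIV. 8 *\<^sub>R Q k - (if k = l then 12 *\<^sub>R Q k else 0))"
      unfolding descartes_expansion(1)[OF Q, of w] S
      by (intro sum.cong) (auto simp: c 2 simp flip: scaleR_left_diff_distrib)
    also have "\<dots> = 4 *\<^sub>R (2 *\<^sub>R (\<Sum>k\<in>UNIV. Q k) - 3 *\<^sub>R Q l)"
      by (simp add: sum_subtractf scaleR_right_diff_distrib flip: scaleR_sum_right)
    finally show ?thesis by (simp add: flip_def)
  qed
qed

text \<open>The fourth vector is \<open>x + y + z + m\<close> with \<open>m\<close> orthogonal to
  all three. As \<open>x + y + z\<close> has norm -3, \<open>m\<close> must have norm 4, and such an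
  \<open>m\<close> exists because a timelike vector has a spacelike complement.\<close>

lemma ex_descartes:
  assumes n: "lorentz x x = 1" "lorentz y y = 1" "lorentz z z = 1"
    and t: "lorentz x y = -1" "lorentz y z = -1" "lorentz x z = -1"
    and fut: "future (x + y)" "future (y + z)" "future (x + z)"
  shows "\<exists>Q. descartes Q \<and> Q 1 = x \<and> Q 2 = y \<and> Q 3 = z"
proof -
  \<comment> \<open>Turns Lorentz products into Euclidean ones, so that a dimension count supplies a
    nonzero vector orthogonal to three given ones.\<close>
  define J :: "lvec \<Rightarrow> lvec" where "J v = (- cocv v / 2, mid v, - cv v / 2)" for v
  have J: "lorentz u v = u \<bullet> J v" for u v
    by (simp add: J_def lorentz_def inner_prod_def algebra_simps add_divide_distrib)
  have "dim {J x, J y, J z} \<le> card {J x, J y, J z}"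
    by (rule dim_le_card') simp
  also have "\<dots> \<le> 3" by (simp add: card_insert_if)
  finally have "dim {J x, J y, J z} < DIM(lvec)" by simp
  then obtain n0 where n0: "n0 \<noteq> 0" "\<And>v. v \<in> span {J x, J y, J z} \<Longrightarrow> orthogonal n0 v"
    using orthogonal_to_subspace_exists by blast
  have orth: "lorentz n0 x = 0" "lorentz n0 y = 0" "lorentz n0 z = 0"
    using n0(2) by (auto simp: J span_base orthogonal_def)
  have t': "lorentz y x = -1" "lorentz z y = -1" "lorentz z x = -1"
    using t by (auto simp: lorentz_commute)
  have "lorentz (x + y + z) (x + y + z) < 0"
    by (simp add: lorentz_simps n t t')
  moreover have "lorentz n0 (x + y + z) = 0" by (simp add: lorentz_simps orth)
  ultimately have pos: "lorentz n0 n0 > 0"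
    using n0 lorentz_pos_if_orthogonal_timelike by blast
  define m where "m = (2 / sqrt (lorentz n0 n0)) *\<^sub>R n0"
  have mm: "lorentz m m = 4" using pos by (simp add: m_def lorentz_simps)
  have m: "lorentz m x = 0" "lorentz m y = 0" "lorentz m z = 0"
    "lorentz x m = 0" "lorentz y m = 0" "lorentz z m = 0"
    using orth by (auto simp: m_def lorentz_simps lorentz_commute)
  define w where "w = x + y + z + m"
  have w: "lorentz w w = 1" "lorentz w x = -1" "lorentz w y = -1" "lorentz w z = -1"
    "lorentz x w = -1" "lorentz y w = -1" "lorentz z w = -1"
    by (auto simp: w_def lorentz_simps m mm n t t')
  have "future (x + w)"
    by (rule future_if_lorentz_neg[of "x + y"]) (use fut in \<open>auto simp: lorentz_simps w n t t'\<close>)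
  moreover have "future (y + w)"
    by (rule future_if_lorentz_neg[of "x + y"]) (use fut in \<open>auto simp: lorentz_simps w n t t'\<close>)
  moreover have "future (z + w)"
    by (rule future_if_lorentz_neg[of "x + z"]) (use fut in \<open>auto simp: lorentz_simps w n t t'\<close>)
  ultimately have fw: "future (x + w)" "future (y + w)" "future (z + w)" .
  define Q :: "4 \<Rightarrow> lvec" where
    "Q i = (if i = 1 then x else if i = 2 then y else if i = 3 then z else w)" for i
  have Qs: "Q 1 = x" "Q 2 = y" "Q 3 = z" "Q 4 = w" by (auto simp: Q_def)
  have "descartes Q"
    unfolding descartes_def forall_4
    using fut fw by (auto simp: Qs n t t' w add.commute)
  then show ?thesis using Qs by blast
qed

section \<open>Paths of exchanges with a set \<open>K\<close> of frozen positions\<close>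

inductive reach :: "4 set \<Rightarrow> (4 \<Rightarrow> lvec) \<Rightarrow> (4 \<Rightarrow> lvec) \<Rightarrow> bool" for K Q0 where
  refl: "reach K Q0 Q0"
| flip: "reach K Q0 Q \<Longrightarrow> j \<notin> K \<Longrightarrow> reach K Q0 (flip j Q)"

lemma reach_mono: "reach K Q0 Q \<Longrightarrow> K' \<subseteq> K \<Longrightarrow> reach K' Q0 Q"
  by (induction rule: reach.induct) (auto intro: reach.intros)

lemma reach_trans: "reach K Q1 Q2 \<Longrightarrow> reach K Q0 Q1 \<Longrightarrow> reach K Q0 Q2"
  by (induction rule: reach.induct) (auto intro: reach.intros)

lemma reach_sym: "reach K Q0 Q \<Longrightarrow> reach K Q Q0"
proof (induction rule: reach.induct)
  case (flip Q j)
  have "reach K (flip j Q) (flip j (flip j Q))"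
    by (intro reach.intros flip)
  then show ?case using flip by (auto intro: reach_trans)
qed (rule reach.refl)

lemma reach_fixed: "reach K Q0 Q \<Longrightarrow> i \<in> K \<Longrightarrow> Q i = Q0 i"
  by (induction rule: reach.induct) (auto simp: flip_def)

lemma reach_descartes: "reach K Q0 Q \<Longrightarrow> descartes Q0 \<Longrightarrow> descartes Q"
  by (induction rule: reach.induct) (auto intro: descartes_flip)

text \<open>Quadruples reached by leaving the frozen family at some step and never undoing the
  preceding exchange; the index records the last exchange.\<close>

inductive departed :: "4 set \<Rightarrow> (4 \<Rightarrow> lvec) \<Rightarrow> (4 \<Rightarrow> lvec) \<Rightarrow> 4 \<Rightarrow> bool" for K Q0 where
  leave: "reach K Q0 Q \<Longrightarrow> j \<in> K \<Longrightarrow> departed K Q0 (flip j Q) j"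
| further: "departed K Q0 Q i \<Longrightarrow> j \<noteq> i \<Longrightarrow> departed K Q0 (flip j Q) j"

text \<open>Paths can be shortened: repeating the last exchange undoes it and leads back to the
  preceding quadruple, which is already covered.\<close>

lemma reach_or_departed:
  assumes "reach {} Q0 Q"
  shows "reach K Q0 Q \<or> (\<exists>i. departed K Q0 Q i)"
  using assms
proof (induction rule: reach.induct)
  case refl
  then show ?case by (simp add: reach.refl)
next
  case (flip Q j)
  then consider "reach K Q0 Q" | i where "departed K Q0 Q i" by blast
  then show ?case
  proof cases
    case 1
    then show ?thesis by (cases "j \<in> K") (auto intro: reach.flip departed.leave)
  next
    case (2 i)
    show ?thesis
    proof (cases "j = i")
      case True
      with 2 show ?thesis by (cases rule: departed.cases) auto
    next
      case False
      with 2 show ?thesis by (auto intro: departed.further)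
    qed
  qed
qed

lemma flip_functional:
  fixes f :: "lvec \<Rightarrow> real"
  assumes "linear f"
  shows "f (flip j Q j) = 2 * (\<Sum>k\<in>UNIV. f (Q k)) - 3 * f (Q j)"
  using assms by (simp add: flip_def linear_diff linear_scale linear_sum sum_distrib_left)

text \<open>A functional that is constant along the frozen family and large after leaving it keeps
  growing, so the disks on which it is small all occur inside the frozen family.\<close>

lemma small_in_frozen_family:
  fixes f :: "lvec \<Rightarrow> real" and v :: "4 \<Rightarrow> real"
  assumes f: "linear f" and v: "\<And>k. f (Q0 k) = v k"
    and stable: "\<And>j. j \<notin> K \<Longrightarrow> (\<Sum>k\<in>UNIV. v k) = 2 * v j"
    and jump: "\<And>j. j \<in> K \<Longrightarrow> \<theta> < 2 * (\<Sum>k\<in>UNIV. v k) - 3 * v j"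
    and bounds: "\<And>j k. j \<in> K \<Longrightarrow> k \<noteq> j \<Longrightarrow> 0 \<le> v k \<and> v k \<le> \<theta>"
    and \<theta>: "\<theta> \<ge> 0"
    and Q: "reach {} Q0 Q" and small: "f (Q k) \<le> \<theta>"
  shows "\<exists>Q' k'. reach K Q0 Q' \<and> Q k = Q' k'"
proof -
  have const: "f (Q k) = v k" if "reach K Q0 Q" for Q k
    using that
  proof (induction arbitrary: k rule: reach.induct)
    \<comment> \<open>With total \<open>2 * v j\<close> the exchanged value is
      \<open>4 * v j - 3 * v j\<close>, so it does not change.\<close>
    case (flip Q j)
    then show ?case
      using stable[of j] by (cases "k = j") (simp_all add: flip_functional[OF f])
  qed (rule v)
  \<comment> \<open>The invariant after departure: all values are nonnegative, the last exchanged
    disk carries the maximum, and this maximum exceeds the threshold.\<close>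
  have dep: "\<theta> < f (Q i) \<and> (\<forall>k. 0 \<le> f (Q k) \<and> f (Q k) \<le> f (Q i) \<and>
      (f (Q k) \<le> \<theta> \<longrightarrow> (\<exists>Q' k'. reach K Q0 Q' \<and> Q k = Q' k')))"
    if "departed K Q0 Q i" for Q i
    using that
  proof (induction rule: departed.induct)
    case (leave Q j)
    have new: "\<theta> < f (flip j Q j)"
      using jump[OF leave(2)] by (simp add: flip_functional[OF f] const[OF leave(1)])
    have "0 \<le> f (flip j Q k) \<and> f (flip j Q k) \<le> f (flip j Q j) \<and>
      (f (flip j Q k) \<le> \<theta> \<longrightarrow> (\<exists>Q' k'. reach K Q0 Q' \<and> flip j Q k = Q' k'))" for k
    proof (cases "k = j")
      case True
      then show ?thesis using new \<theta> by auto
    next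
      case False
      then have "flip j Q k = Q k" by simp
      moreover have "0 \<le> f (Q k)" "f (Q k) \<le> \<theta>"
        using bounds[OF leave(2) False] const[OF leave(1)] by auto
      ultimately show ?thesis using new leave(1) by auto
    qed
    then show ?case using new by blast
  next
    case (further Q i j)
    have IH: "\<theta> < f (Q i)" "0 \<le> f (Q k)" "f (Q k) \<le> f (Q i)"
      "f (Q k) \<le> \<theta> \<Longrightarrow> \<exists>Q' k'. reach K Q0 Q' \<and> Q k = Q' k'" for k
      using further.IH by auto
    \<comment> \<open>The new value is twice the sum over the positions other than \<open>j\<close>,
      minus \<open>f (Q j)\<close>. That sum contains the maximum \<open>f (Q i)\<close>, so the new
      value is at least \<open>2 * f (Q i) - f (Q j)\<close>, hence at least
      \<open>f (Q i)\<close>.\<close>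
    have "f (Q i) \<le> (\<Sum>k\<in>UNIV - {j}. f (Q k))"
      using further.hyps(2) IH by (intro member_le_sum) auto
    moreover have "(\<Sum>k\<in>UNIV. f (Q k)) = f (Q j) + (\<Sum>k\<in>UNIV - {j}. f (Q k))"
      by (subst sum.remove[of _ j]) auto
    ultimately have new: "f (Q i) \<le> f (flip j Q j)"
      using IH(3)[of j] by (simp add: flip_functional[OF f])
    have "0 \<le> f (flip j Q k) \<and> f (flip j Q k) \<le> f (flip j Q j) \<and>
      (f (flip j Q k) \<le> \<theta> \<longrightarrow> (\<exists>Q' k'. reach K Q0 Q' \<and> flip j Q k = Q' k'))" for k
    proof (cases "k = j")
      case True
      then show ?thesis using new IH(1) \<theta> by auto
    next
      case False
      then have "flip j Q k = Q k" by simp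
      then show ?thesis using new IH(2-4)[of k] by auto
    qed
    then show ?case using new IH(1) by force
  qed
  show ?thesis
    using reach_or_departed[OF Q, of K] dep small by blast
qed

lemma linear_lorentz: "linear (\<lambda>y. - lorentz y x)"
  by (rule linearI) (auto simp: lorentz_simps)

text \<open>The negated product with \<open>Q0 i\<close> is -1 at position \<open>i\<close> and 1 at
  the others. Exchanging position \<open>i\<close> makes it jump to 7, beyond the value 1 of a
  tangent disk.\<close>

lemma tangent_in_common_quadruple:
  assumes Q0: "descartes Q0" and Q: "reach {} Q0 Q" and t: "lorentz (Q k) (Q0 i) = -1"
  shows "\<exists>Q' k'. reach {i} Q0 Q' \<and> Q k = Q' k' \<and> k' \<noteq> i"
proof -
  have gram: "lorentz (Q0 i) (Q0 k) = (if i = k then 1 else -1)" for i k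
    using Q0 by (simp add: descartes_def)
  have "\<exists>Q' k'. reach {i} Q0 Q' \<and> Q k = Q' k'"
  proof (rule small_in_frozen_family[where f = "\<lambda>y. - lorentz y (Q0 i)" and \<theta> = 1
        and v = "\<lambda>k. if k = i then -1 else 1"])
    show "reach {} Q0 Q" by (rule Q)
  qed (auto simp: linear_lorentz gram sum_delta_4 t)
  then obtain Q' k' where *: "reach {i} Q0 Q'" "Q k = Q' k'" by blast
  have "k' \<noteq> i"
    using reach_fixed[OF *(1), of i] * t gram[of i i] by auto
  with * show ?thesis by blast
qed

text \<open>Adding the functionals of the two disks gives 0 at \<open>i\<close> and \<open>j\<close>
  and 2 elsewhere. Exchanging either disk gives 8, while a disk tangent to both has value 2.\<close>

lemma triple_in_common_quadruple:
  assumes Q0: "descartes Q0" and Q: "reach {} Q0 Q" and "i \<noteq> j"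
    and t: "lorentz (Q k) (Q0 i) = -1" "lorentz (Q k) (Q0 j) = -1"
  shows "\<exists>Q' k'. reach {i, j} Q0 Q' \<and> Q k = Q' k' \<and> k' \<noteq> i \<and> k' \<noteq> j"
proof -
  have gram: "lorentz (Q0 i) (Q0 k) = (if i = k then 1 else -1)" for i k
    using Q0 by (simp add: descartes_def)
  have S: "(\<Sum>k\<in>UNIV. if k = i \<or> k = j then 0 else 2) = (4::real)"
  proof -
    have "(\<Sum>k\<in>UNIV. if k = i \<or> k = j then 0 else 2) =
        (\<Sum>k\<in>UNIV. (if k = i then -1 else 1) + (if k = j then -1 else (1::real)))"
      using \<open>i \<noteq> j\<close> by (intro sum.cong) auto
    then show ?thesis by (simp add: sum.distrib sum_delta_4)
  qed
  have "\<exists>Q' k'. reach {i, j} Q0 Q' \<and> Q k = Q' k'"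
  proof (rule small_in_frozen_family[where f = "\<lambda>y. - lorentz y (Q0 i + Q0 j)" and \<theta> = 2
        and v = "\<lambda>k. if k = i \<or> k = j then 0 else 2"])
    show "linear (\<lambda>y. - lorentz y (Q0 i + Q0 j))" by (rule linear_lorentz)
    show "reach {} Q0 Q" by (rule Q)
  qed (use \<open>i \<noteq> j\<close> in \<open>auto simp: lorentz_add_right gram S t\<close>)
  then obtain Q' k' where *: "reach {i, j} Q0 Q'" "Q k = Q' k'" by blast
  have "k' \<noteq> i \<and> k' \<noteq> j"
    using reach_fixed[OF *(1)] * t gram[of i i] gram[of j j] by auto
  with * show ?thesis by blast
qed

section \<open>Quadruples in the packing\<close>

lemma descartes_norm: "descartes Q \<Longrightarrow> lorentz (Q i) (Q i) = 1"
  by (simp add: descartes_def)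

lemma descartes_tangent:
  assumes Q: "descartes Q" and "i \<noteq> j"
  shows "tangent (vec_disk (Q i)) (vec_disk (Q j))"
proof -
  have gram: "lorentz (Q i) (Q k) = (if i = k then 1 else -1)" for i k
    using Q by (simp add: descartes_def)
  obtain k where "k \<noteq> i" "k \<noteq> j" using ex_index_not_in[of i j j] by auto
  \<comment> \<open>A third member, having product -2 with the sum, shows that the two regions are
    not complementary.\<close>
  then have "lorentz (Q i + Q j) (Q k) \<noteq> 0" by (simp add: lorentz_simps gram)
  then have "Q i + Q j \<noteq> 0" by (metis lorentz_zero_left)
  then show ?thesis
    using Q \<open>i \<noteq> j\<close>
    by (intro tangentI) (auto simp: valid_vec_disk disk_vec_vec_disk descartes_norm descartes_def)
qed

text \<open>Exchange paths are reversible, so any reached quadruple can serve as the base. First the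
  second disk is moved into a quadruple with the first; then, with both frozen, the third joins
  them.\<close>

lemma triple_common:
  assumes Q0: "descartes Q0"
    and x: "reach {} Q0 Qx" and y: "reach {} Q0 Qy" and z: "reach {} Q0 Qz"
    and t: "lorentz (Qx i) (Qy j) = -1" "lorentz (Qy j) (Qz k) = -1" "lorentz (Qx i) (Qz k) = -1"
  shows "\<exists>Q i' j' k'. reach {} Q0 Q \<and> i' \<noteq> j' \<and> k' \<noteq> i' \<and> k' \<noteq> j' \<and>
    Q i' = Qx i \<and> Q j' = Qy j \<and> Q k' = Qz k"
proof -
  have "descartes Qx" using x Q0 by (rule reach_descartes)
  moreover have "reach {} Qx Qy" using x y by (meson reach_sym reach_trans)
  ultimately obtain Q1 j' where Q1: "reach {i} Qx Q1" "Qy j = Q1 j'" "j' \<noteq> i"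
    using tangent_in_common_quadruple[of Qx Qy j i] t by (auto simp: lorentz_commute)
  have "Q1 i = Qx i" using reach_fixed[OF Q1(1)] by simp
  have r1: "reach {} Q0 Q1" using Q1(1) x by (meson reach_mono reach_trans empty_subsetI)
  have "descartes Q1" using r1 Q0 by (rule reach_descartes)
  moreover have "reach {} Q1 Qz" using r1 z by (meson reach_sym reach_trans)
  ultimately obtain Q2 k' where Q2: "reach {i, j'} Q1 Q2" "Qz k = Q2 k'" "k' \<noteq> i" "k' \<noteq> j'"
    using triple_in_common_quadruple[of Q1 Qz i j' k] t Q1 \<open>Q1 i = Qx i\<close>
    by (auto simp: lorentz_commute)
  have "Q2 i = Qx i" "Q2 j' = Qy j"
    using reach_fixed[OF Q2(1)] \<open>Q1 i = Qx i\<close> Q1 by auto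
  moreover have "reach {} Q0 Q2" using Q2(1) r1 by (meson reach_mono reach_trans empty_subsetI)
  ultimately show ?thesis using Q1 Q2 by metis
qed

lemma UNIV_eq_4:
  assumes "distinct [i, j, k, l :: 4]"
  shows "UNIV = {i, j, k, l}"
  using assms by (intro card_subset_eq[symmetric]) auto

lemma flip_eq:
  assumes "distinct [i, j, k, l]"
  shows "flip l Q l = 2 *\<^sub>R (Q i + Q j + Q k) - Q l"
proof -
  have "flip l Q l = 2 *\<^sub>R (Q i + Q j + Q k + Q l) - 3 *\<^sub>R Q l"
    using assms unfolding flip_def UNIV_eq_4[OF assms] by (simp add: add.assoc)
  also have "\<dots> = 2 *\<^sub>R (Q i + Q j + Q k) - Q l"
    by (simp only: prod_eq_iff complex_eq_iff) simp
  finally show ?thesis .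
qed

lemma apollonian_disks_descartes:
  assumes "descartes Q" and A: "\<And>k. k \<noteq> l \<Longrightarrow> vec_disk (Q k) \<in> apollonian_disks D1 D2 D3"
  shows "vec_disk (Q l) \<in> apollonian_disks D1 D2 D3"
proof -
  obtain i where i: "i \<noteq> l" using ex_index_not_in[of l l l] by auto
  obtain j where j: "j \<noteq> l" "j \<noteq> i" using ex_index_not_in[of l i i] by auto
  obtain k where k: "k \<noteq> l" "k \<noteq> i" "k \<noteq> j" using ex_index_not_in[of l i j] by auto
  show ?thesis
    by (rule apollonian_disks.adjoin[of "vec_disk (Q i)" _ _ _ "vec_disk (Q j)" "vec_disk (Q k)"])
      (use i j k in \<open>auto simp: mutually_tangent_def intro!: A descartes_tangent assms(1)\<close>)
qed

text \<open>Identifies the packing with the disks of one orbit of quadruples.\<close>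

lemma apollonian_disks_eq:
  assumes mt: "mutually_tangent D1 D2 D3"
  obtains Q0 where "descartes Q0"
    and "\<And>Q k. reach {} Q0 Q \<Longrightarrow> vec_disk (Q k) \<in> apollonian_disks D1 D2 D3"
    and "\<And>X. X \<in> apollonian_disks D1 D2 D3 \<Longrightarrow> valid_disk X \<and> (\<exists>Q k. reach {} Q0 Q \<and> disk_vec X = Q k)"
proof -
  let ?A = "apollonian_disks D1 D2 D3"
  have v: "valid_disk D1" "valid_disk D2" "valid_disk D3"
    using mt by (auto simp: mutually_tangent_def tangent_def)
  obtain Q0 where Q0: "descartes Q0" "Q0 1 = disk_vec D1" "Q0 2 = disk_vec D2" "Q0 3 = disk_vec D3"
    using ex_descartes[of "disk_vec D1" "disk_vec D2" "disk_vec D3"] mt v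
    by (auto simp: mutually_tangent_def lorentz_disk_vec tangent_disk_vec)
  have inA: "\<forall>k. vec_disk (Q k) \<in> ?A" if "reach {} Q0 Q" for Q
    using that
  proof (induction rule: reach.induct)
    case refl
    have other: "vec_disk (Q0 k) \<in> ?A" if "k \<noteq> 4" for k
      using exhaust_4[of k] that Q0 v by (auto simp: vec_disk_disk_vec intro: apollonian_disks.intros)
    have "vec_disk (Q0 4) \<in> ?A"
      by (rule apollonian_disks_descartes[OF Q0(1) other])
    then have "vec_disk (Q0 k) \<in> ?A" for k
      using other by (cases "k = 4") simp_all
    then show ?case ..
  next
    case (flip Q j)
    have "descartes (flip j Q)" by (rule descartes_flip[OF reach_descartes[OF flip.hyps(1) Q0(1)]])
    moreover have other: "vec_disk (flip j Q k) \<in> ?A" if "k \<noteq> j" for k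
      using flip.IH that by simp
    ultimately have "vec_disk (flip j Q j) \<in> ?A"
      by (rule apollonian_disks_descartes)
    then have "vec_disk (flip j Q k) \<in> ?A" for k
      using other by (cases "k = j") simp_all
    then show ?case ..
  qed
  have "valid_disk X \<and> (\<exists>Q k. reach {} Q0 Q \<and> disk_vec X = Q k)" if "X \<in> ?A" for X
    using that
  proof induction
    case first
    then show ?case using v Q0(2-4) reach.refl[of "{}" Q0] by metis
  next
    case second
    then show ?case using v Q0(2-4) reach.refl[of "{}" Q0] by metis
  next
    case third
    then show ?case using v Q0(2-4) reach.refl[of "{}" Q0] by metis
  next
    case (adjoin X Y Z W)
    have W: "valid_disk W" using adjoin by (simp add: tangent_def)
    obtain Qx Qy Qz i0 j0 k0 where xyz: "reach {} Q0 Qx" "disk_vec X = Qx i0"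
      "reach {} Q0 Qy" "disk_vec Y = Qy j0" "reach {} Q0 Qz" "disk_vec Z = Qz k0"
      using adjoin.IH by metis
    have "lorentz (Qx i0) (Qy j0) = -1" "lorentz (Qy j0) (Qz k0) = -1" "lorentz (Qx i0) (Qz k0) = -1"
      using adjoin.hyps unfolding xyz(2,4,6)[symmetric] mutually_tangent_def
      by (auto intro: tangent_disk_vec)
    \<comment> \<open>The three parents may come from different quadruples. In a common one, the
      adjoined disk has to be the fourth member or its exchange.\<close>
    from triple_common[OF Q0(1) xyz(1,3,5) this]
    obtain Q i j k where Q: "reach {} Q0 Q" "i \<noteq> j" "k \<noteq> i" "k \<noteq> j"
      "Q i = disk_vec X" "Q j = disk_vec Y" "Q k = disk_vec Z"
      using xyz by metis
    obtain l where l: "l \<noteq> i" "l \<noteq> j" "l \<noteq> k" using ex_index_not_in by blast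
    have UN: "UNIV = {i, j, k, l}" using Q l by (intro UNIV_eq_4) auto
    have "lorentz (disk_vec W) (Q m) = -1" if "m \<noteq> l" for m
    proof -
      have "m \<in> {i, j, k}" using that UN by auto
      then show ?thesis using Q adjoin.hyps by (auto simp: tangent_disk_vec)
    qed
    then have "disk_vec W = Q l \<or> disk_vec W = flip l Q l"
      by (intro descartes_fourth reach_descartes[OF Q(1) Q0(1)] lorentz_disk_vec W)
    moreover have "reach {} Q0 (flip l Q)" using Q by (auto intro: reach.flip)
    ultimately show ?case using Q(1) W by blast
  qed
  then show ?thesis using that Q0 inA by blast
qed

section \<open>The quadratic form of a corona\<close>

text \<open>The null vector \<open>D + X\<close> as a quadratic form in \<open>(m, n)\<close>; the
  mixed coefficient is the one that gives \<open>G\<close> at \<open>(1, 1)\<close>.\<close>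

definition corona_vec :: "lvec \<Rightarrow> lvec \<Rightarrow> lvec \<Rightarrow> lvec \<Rightarrow> int \<Rightarrow> int \<Rightarrow> lvec" where
  "corona_vec D E F G m n = - D + (of_int m)\<^sup>2 *\<^sub>R (D + E) + (of_int n)\<^sup>2 *\<^sub>R (D + F)
     + (of_int m * of_int n) *\<^sub>R (G - D - E - F)"

lemma corona_vec_units:
  "corona_vec D E F G 1 0 = E" "corona_vec D E F G 0 1 = F" "corona_vec D E F G 1 1 = G"
  by (auto simp: corona_vec_def)

lemma corona_vec_uminus: "corona_vec D E F G (- m) (- n) = corona_vec D E F G m n"
  by (simp add: corona_vec_def)

text \<open>The parallelogram law for this form, arranged like the exchange formula
  \<open>flip_eq\<close>.\<close>

lemma corona_vec_parallelogram:
  "2 *\<^sub>R (D + corona_vec D E F G p q + corona_vec D E F G r s) - corona_vec D E F G (p + r) (q + s)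
   = corona_vec D E F G (p - r) (q - s)"
  unfolding corona_vec_def
  by (simp only: prod_eq_iff complex_eq_iff) (simp add: algebra_simps power2_eq_square)

text \<open>The product depends only on a determinant: disks of the family have product -1 exactly
  for determinant 1 or -1.\<close>

lemma lorentz_corona_vec:
  assumes Q: "descartes Q" and "distinct [i, j, k, l]"
  defines "X \<equiv> corona_vec (Q i) (Q j) (Q k) (Q l)"
  shows "lorentz (Q i) (X p q) = -1"
    and "lorentz (X p q) (X r s) = 1 - 2 * (of_int (p * s - q * r))\<^sup>2"
proof -
  have gram: "lorentz (Q i) (Q k) = (if i = k then 1 else -1)" for i k
    using Q by (simp add: descartes_def)
  have ne: "i \<noteq> j" "i \<noteq> k" "i \<noteq> l" "j \<noteq> k" "j \<noteq> l" "k \<noteq> l"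
    "j \<noteq> i" "k \<noteq> i" "l \<noteq> i" "k \<noteq> j" "l \<noteq> j" "l \<noteq> k"
    using assms(2) by auto
  show "lorentz (Q i) (X p q) = -1"
    by (simp add: X_def corona_vec_def lorentz_simps gram ne)
  show "lorentz (X p q) (X r s) = 1 - 2 * (of_int (p * s - q * r))\<^sup>2"
    unfolding X_def corona_vec_def lorentz_simps
    by (simp add: gram ne power2_eq_square algebra_simps)
qed

lemma corona_vec_eq_iff:
  assumes Q: "descartes Q" and d: "distinct [i, j, k, l]"
  defines "X \<equiv> corona_vec (Q i) (Q j) (Q k) (Q l)"
  shows "X p q = X r s \<longleftrightarrow> (r, s) = (p, q) \<or> (r, s) = (- p, - q)"
proof
  assume eq: "X p q = X r s"
  have sq: "(a :: int)\<^sup>2 = b\<^sup>2" if "(of_int a :: real)\<^sup>2 = (of_int b)\<^sup>2" for a b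
    using that by (metis of_int_eq_iff of_int_power)
  have "(p * v - q * u)\<^sup>2 = (r * v - s * u)\<^sup>2" for u v
    by (rule sq) (use lorentz_corona_vec(2)[OF Q d, of p q u v]
      lorentz_corona_vec(2)[OF Q d, of r s u v] eq in \<open>simp add: X_def\<close>)
  \<comment> \<open>The first two test vectors determine the coordinates up to sign, the third their
    relative sign.\<close>
  from this[where v = 1 and u = 0] this[where v = 0 and u = 1] this[where v = 1 and u = 1]
  have "p\<^sup>2 = r\<^sup>2" "q\<^sup>2 = s\<^sup>2" "(p - q)\<^sup>2 = (r - s)\<^sup>2" by auto
  then have "p = r \<or> p = - r" "q = s \<or> q = - s" "p * q = r * s"
    by (auto simp: power2_eq_iff power2_diff)
  then show "(r, s) = (p, q) \<or> (r, s) = (- p, - q)" by auto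
next
  assume "(r, s) = (p, q) \<or> (r, s) = (- p, - q)"
  then show "X p q = X r s" by (auto simp: X_def corona_vec_uminus)
qed

section \<open>Unimodular pairs and the Euclidean algorithm\<close>

lemma coprime_if_det:
  fixes p q r s :: int
  assumes "\<bar>p * s - q * r\<bar> = 1"
  shows "coprime p q"
proof (rule coprimeI)
  fix c assume "c dvd p" "c dvd q"
  then have "c dvd \<bar>p * s - q * r\<bar>" by simp
  then show "is_unit c" using assms by simp
qed

lemma frozen_family_subset_corona_vec:
  assumes Q0: "descartes Q0" and d: "distinct [i, j, k, l]" and Q: "reach {i} Q0 Q" and "m \<noteq> i"
  shows "\<exists>p q. coprime p q \<and> Q m = corona_vec (Q0 i) (Q0 j) (Q0 k) (Q0 l) p q"
proof -
  define X where "X = corona_vec (Q0 i) (Q0 j) (Q0 k) (Q0 l)"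
  have even: "X (- a) (- b) = X a b" for a b by (simp add: X_def corona_vec_uminus)
  have para: "2 *\<^sub>R (Q0 i + X p q + X r s) - X (p + r) (q + s) = X (p - r) (q - s)" for p q r s
    by (simp add: X_def corona_vec_parallelogram)
  \<comment> \<open>The three moving disks always sit at two vectors of determinant 1 or -1 and at
    their sum. An exchange replaces one of the three; the signs of the new witnesses are chosen so
    that the third is again the sum, which evenness of \<open>X\<close> permits.\<close>
  have "\<exists>p q r s. \<bar>p * s - q * r\<bar> = 1 \<and> Q j = X p q \<and> Q k = X r s \<and> Q l = X (p + r) (q + s)"
    using Q
  proof (induction rule: reach.induct)
    case refl
    show ?case
      by (intro exI[of _ 1] exI[of _ 0] exI[of _ 0] exI[of _ 1]) (simp add: X_def corona_vec_units)
  next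
    case (flip Q h)
    then obtain p q r s where *: "\<bar>p * s - q * r\<bar> = 1" "Q j = X p q" "Q k = X r s"
      "Q l = X (p + r) (q + s)" by blast
    have Qi: "Q i = Q0 i" using reach_fixed[OF flip.hyps(1)] by simp
    have "h \<in> {i, j, k, l}" using UNIV_eq_4[OF d] by blast
    then consider "h = j" | "h = k" | "h = l" using flip.hyps by auto
    then show ?case
    proof cases
      case 1
      have "flip h Q j = X (p + 2 * r) (q + 2 * s)"
        using flip_eq[of i k l j Q] d para[of "p + r" "q + s" r s] para[of "p + r" "q + s" "- r" "- s"] 1
        by (auto simp: * Qi even add_ac)
      then show ?thesis
        using * d 1 by (intro exI[of _ "p + 2 * r"] exI[of _ "q + 2 * s"] exI[of _ "- r"] exI[of _ "- s"])
          (auto simp: even algebra_simps)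
    next
      case 2
      have "flip h Q k = X (2 * p + r) (2 * q + s)"
        using flip_eq[of i j l k Q] d para[of "p + r" "q + s" "- p" "- q"] 2
        by (auto simp: * Qi even add_ac)
      then show ?thesis
        using * d 2 by (intro exI[of _ "- p"] exI[of _ "- q"] exI[of _ "2 * p + r"] exI[of _ "2 * q + s"])
          (auto simp: even algebra_simps)
    next
      case 3
      have "flip h Q l = X (p - r) (q - s)"
        using flip_eq[of i j k l Q] d para[of p q r s] 3 by (auto simp: * Qi)
      then show ?thesis
        using * d 3 by (intro exI[of _ p] exI[of _ q] exI[of _ "- r"] exI[of _ "- s"])
          (auto simp: even algebra_simps)
    qed
  qed
  then obtain p q r s where *: "\<bar>p * s - q * r\<bar> = 1" "Q j = X p q" "Q k = X r s"
    "Q l = X (p + r) (q + s)" by blast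
  have "\<bar>r * q - s * p\<bar> = 1" "\<bar>(p + r) * s - (q + s) * r\<bar> = 1"
    using *(1) by (auto simp: algebra_simps)
  then have "coprime p q" "coprime r s" "coprime (p + r) (q + s)"
    using *(1) by (auto intro: coprime_if_det)
  moreover have "m \<in> {j, k, l}" using UNIV_eq_4[OF d] \<open>m \<noteq> i\<close> by blast
  ultimately show ?thesis using * unfolding X_def by blast
qed

text \<open>Complete \<open>(m, n)\<close> to a unimodular pair by Bezout and run the subtractive
  Euclidean algorithm on the first coordinates. Each subtraction is undone by an exchange that keeps
  \<open>D\<close> fixed.\<close>

lemma corona_vec_in_frozen_family:
  assumes Q0: "descartes Q0" and d: "distinct [i, j, k, l]" and "coprime m n"
  shows "\<exists>Q h. reach {i} Q0 Q \<and> h \<noteq> i \<and> Q h = corona_vec (Q0 i) (Q0 j) (Q0 k) (Q0 l) m n"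
proof -
  define X where "X = corona_vec (Q0 i) (Q0 j) (Q0 k) (Q0 l)"
  define P where "P p q r s \<longleftrightarrow> (\<exists>Q a b. reach {i} Q0 Q \<and> a \<noteq> i \<and> b \<noteq> i \<and> a \<noteq> b \<and>
    Q a = X p q \<and> Q b = X r s)" for p q r s
  have even: "X (- a) (- b) = X a b" for a b by (simp add: X_def corona_vec_uminus)
  have base: "P 1 0 0 1"
    unfolding P_def using d
    by (intro exI[of _ Q0] exI[of _ j] exI[of _ k]) (auto simp: X_def corona_vec_units intro: reach.refl)
  have sym: "P r s p q" if "P p q r s" for p q r s
    using that unfolding P_def by metis
  have neg1: "P (- p) (- q) r s \<longleftrightarrow> P p q r s" and neg2: "P p q (- r) (- s) \<longleftrightarrow> P p q r s"
    for p q r s by (simp_all add: P_def even)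
  \<comment> \<open>The sum vector gives a disk tangent to \<open>Q i\<close>, \<open>Q a\<close>
    and \<open>Q b\<close>, so it is the remaining member \<open>Q c\<close> or its
    exchange.\<close>
  have add: "P p q (p + r) (q + s)" if P: "P p q r s" and det: "\<bar>p * s - q * r\<bar> = 1" for p q r s
  proof -
    obtain Q a b where Q: "reach {i} Q0 Q" "a \<noteq> i" "b \<noteq> i" "a \<noteq> b" "Q a = X p q" "Q b = X r s"
      using P unfolding P_def by blast
    have desc: "descartes Q" using Q(1) Q0 by (rule reach_descartes)
    have Qi: "Q i = Q0 i" using reach_fixed[OF Q(1)] by simp
    obtain c where c: "c \<noteq> i" "c \<noteq> a" "c \<noteq> b" using ex_index_not_in by blast
    have UN: "UNIV = {i, a, b, c}" using Q c by (intro UNIV_eq_4) auto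
    have lX: "lorentz (X u v) (X u' v') = 1 - 2 * (of_int (u * v' - v * u'))\<^sup>2" for u v u' v'
      unfolding X_def by (rule lorentz_corona_vec(2)[OF Q0 d])
    have det2: "(of_int (p * s - q * r) :: real)\<^sup>2 = 1"
      using det by (metis of_int_1 of_int_abs power2_abs power_one)
    have e: "(p + r) * q - (q + s) * p = - (p * s - q * r)" "(p + r) * s - (q + s) * r = p * s - q * r"
      by (simp_all add: algebra_simps)
    have "lorentz (X (p + r) (q + s)) (Q h) = -1" if "h \<noteq> c" for h
    proof -
      have "h \<in> {i, a, b}" using UN that by auto
      moreover have "lorentz (X (p + r) (q + s)) (Q i) = -1"
        using lorentz_corona_vec(1)[OF Q0 d] by (simp add: X_def Qi lorentz_commute)
      moreover have "lorentz (X (p + r) (q + s)) (Q a) = -1" "lorentz (X (p + r) (q + s)) (Q b) = -1"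
        unfolding Q(5,6) lX e of_int_minus power2_minus det2 by simp_all
      ultimately show ?thesis by blast
    qed
    moreover have "lorentz (X (p + r) (q + s)) (X (p + r) (q + s)) = 1"
      unfolding lX by (simp add: mult.commute)
    ultimately have "X (p + r) (q + s) = Q c \<or> X (p + r) (q + s) = flip c Q c"
      using desc by (intro descartes_fourth)
    moreover have "reach {i} Q0 (flip c Q)" using Q(1) c by (intro reach.flip) auto
    moreover have "flip c Q a = X p q" using c Q by simp
    ultimately show ?thesis
      unfolding P_def using Q c by metis
  qed
  have sub: "P p q (r - p) (s - q)" if "P p q r s" and det: "\<bar>p * s - q * r\<bar> = 1" for p q r s
  proof -
    have "\<bar>p * - s - q * - r\<bar> = 1" using det by (simp add: algebra_simps)
    then have "P p q (p + - r) (q + - s)" using that add neg2 by blast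
    then show ?thesis using neg2[of p q "r - p" "s - q"] by simp
  qed
  have unit: "P 0 1 1 s" for s
  proof (induction s rule: int_induct[where k = 0])
    case base
    show ?case using \<open>P 1 0 0 1\<close> by (rule sym)
  next
    case (step1 s)
    then show ?case using add[of 0 1 1 s] by (simp add: add.commute)
  next
    case (step2 s)
    then show ?case using sub[of 0 1 1 s] by simp
  qed
  have zero: "P 0 q r s" if "\<bar>q * r\<bar> = 1" for q r s
  proof -
    have "\<bar>q\<bar> = 1" "\<bar>r\<bar> = 1" using that by (auto simp: abs_mult zmult_eq_1_iff)
    then have "q = 1 \<or> q = -1" "r = 1 \<or> r = -1" by auto
    then show ?thesis
      using unit[of s] unit[of "- s"] neg1[of 0 1 r s] neg2[of 0 1 1 "- s"] by auto
  qed
  \<comment> \<open>Descent on \<open>p + r\<close>; a vanishing first coordinate is the end of the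
    algorithm, settled by \<open>zero\<close>.\<close>
  have main: "P p q r s" if "p \<ge> 0" "r \<ge> 0" "\<bar>p * s - q * r\<bar> = 1" for p q r s
    using that
  proof (induction "nat (p + r)" arbitrary: p q r s rule: less_induct)
    case less
    consider "p = 0" | "r = 0" | "p > 0" "r \<ge> p" | "r > 0" "p \<ge> r"
      using less.prems by linarith
    then show ?case
    proof cases
      case 1
      then show ?thesis using less.prems zero by simp
    next
      case 2
      then have "P r s p q" using less.prems zero[of s p q] by (simp add: mult.commute)
      then show ?thesis by (rule sym)
    next
      case 3
      have det: "\<bar>p * (s - q) - q * (r - p)\<bar> = 1" using less.prems by (simp add: algebra_simps)
      have "P p q (r - p) (s - q)"
        using 3 less.prems det by (intro less.hyps) auto
      from add[OF this det] show ?thesis by simp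
    next
      case 4
      have det: "\<bar>(p - r) * s - (q - s) * r\<bar> = 1" using less.prems by (simp add: algebra_simps)
      have "P (p - r) (q - s) r s"
        using 4 less.prems det by (intro less.hyps) auto
      then have "P r s (p - r) (q - s)" by (rule sym)
      moreover have "\<bar>r * (q - s) - s * (p - r)\<bar> = 1" using det by (simp add: algebra_simps abs_minus_commute)
      ultimately have "P r s (r + (p - r)) (s + (q - s))" by (rule add)
      then show ?thesis using sym by simp
    qed
  qed
  obtain u v where "u * m + v * n = 1"
    using \<open>coprime m n\<close> by (metis bezout_int coprime_iff_gcd_eq_1)
  \<comment> \<open>Evenness allows nonnegative first coordinates, as the descent demands. The
    partner is \<open>(v, - u)\<close> up to sign, so the Bezout identity becomes the
    determinant.\<close>
  define p q where "p = \<bar>m\<bar>" and "q = (if m \<ge> 0 then n else - n)"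
  define r s where "r = \<bar>v\<bar>" and "s = (if v \<ge> 0 then - u else u)"
  have "\<bar>p * s - q * r\<bar> = \<bar>u * m + v * n\<bar>"
    by (auto simp: p_def q_def r_def s_def abs_if algebra_simps)
  then have "P p q r s"
    using \<open>u * m + v * n = 1\<close> by (intro main) (auto simp: p_def r_def)
  moreover have "X p q = X m n"
    using even[of m n] by (auto simp: p_def q_def)
  ultimately show ?thesis unfolding P_def X_def by metis
qed

section \<open>Spinor products in terms of curvatures\<close>

lemma inner_spinor_squares:
  "(cv x *\<^sub>R mid y - cv y *\<^sub>R mid x) \<bullet> (cv x *\<^sub>R mid z - cv z *\<^sub>R mid x) =
   (cv x)\<^sup>2 * lorentz y z - cv x * cv z * lorentz y x - cv x * cv y * lorentz x z
   + cv y * cv z * lorentz x x"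
  by (simp add: lorentz_def inner_diff_left inner_diff_right inner_commute power2_eq_square
      algebra_simps add_divide_distrib diff_divide_distrib)

text \<open>The squared norm of the square of the spinor is \<open>(A + B)^2\<close> for the two
  curvatures; the root has the right sign because the sum of the disk vectors is future.\<close>

lemma tangency_spinor_norm:
  assumes "tangency_spinor X Y (Complex a b)"
  shows "a\<^sup>2 + b\<^sup>2 = curvature X + curvature Y"
proof -
  have t: "tangent X Y" using assms by (simp add: tangency_spinor_def)
  let ?x = "disk_vec X" and ?y = "disk_vec Y"
  have l: "lorentz ?x ?x = 1" "lorentz ?y ?y = 1" "lorentz ?x ?y = -1" "lorentz ?y ?x = -1"
    using t tangent_disk_vec(1)[OF t] by (auto simp: tangent_def lorentz_disk_vec lorentz_commute)
  have "(a\<^sup>2 + b\<^sup>2)\<^sup>2 = (Complex a b)\<^sup>2 \<bullet> (Complex a b)\<^sup>2"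
    by (simp add: inner_complex_def power2_eq_square algebra_simps)
  also have "\<dots> = (cv ?x + cv ?y)\<^sup>2"
    unfolding tangency_spinor_square[OF assms] inner_spinor_squares l
    by (simp add: power2_eq_square algebra_simps)
  finally have "a\<^sup>2 + b\<^sup>2 = cv ?x + cv ?y"
    using tangent_disk_vec(2)[OF t] by (simp add: future_def power2_eq_iff_nonneg)
  then show ?thesis by (simp add: cv_disk_vec)
qed

text \<open>The double-angle identity \<open>2 (u . v)^2 = |u|^2 |v|^2 + u^2 . v^2\<close> reduces
  the claim to spinor squares, where the sign ambiguity disappears.\<close>

lemma tangency_spinor_inner:
  assumes u: "tangency_spinor X Y (Complex a b)" and v: "tangency_spinor X Z (Complex c d)"
    and YZ: "tangent Y Z"
  shows "(a * c + b * d)\<^sup>2 =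
    curvature X * curvature Y + curvature X * curvature Z + curvature Y * curvature Z"
proof -
  have t: "tangent X Y" "tangent X Z" using u v by (simp_all add: tangency_spinor_def)
  let ?x = "disk_vec X" and ?y = "disk_vec Y" and ?z = "disk_vec Z"
  have l: "lorentz ?x ?x = 1" "lorentz ?y ?x = -1" "lorentz ?x ?z = -1" "lorentz ?y ?z = -1"
    using t tangent_disk_vec(1)[OF t(1)] tangent_disk_vec(1)[OF t(2)] tangent_disk_vec(1)[OF YZ]
    by (auto simp: tangent_def lorentz_disk_vec lorentz_commute)
  have "2 * (a * c + b * d)\<^sup>2 =
      (a\<^sup>2 + b\<^sup>2) * (c\<^sup>2 + d\<^sup>2) + (Complex a b)\<^sup>2 \<bullet> (Complex c d)\<^sup>2"
    by (simp add: inner_complex_def power2_eq_square algebra_simps)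
  also have "\<dots> = 2 * (curvature X * curvature Y + curvature X * curvature Z + curvature Y * curvature Z)"
    unfolding tangency_spinor_square[OF u] tangency_spinor_square[OF v] inner_spinor_squares l
      tangency_spinor_norm[OF u] tangency_spinor_norm[OF v]
    unfolding cv_disk_vec by (simp add: power2_eq_square algebra_simps)
  finally show ?thesis by simp
qed

text \<open>The null vector \<open>(0, 0, -2)\<close> stands for the point at infinity, and its
  products are the curvatures.\<close>

lemma descartes_circle_theorem:
  assumes "descartes Q"
  shows "2 * (\<Sum>k\<in>UNIV. (cv (Q k))\<^sup>2) = (\<Sum>k\<in>UNIV. cv (Q k))\<^sup>2"
proof -
  have "lorentz (0, 0, -2) x = cv x" for x by (simp add: lorentz_def)
  moreover have "lorentz (0, 0, -2) (0, 0, -2) = 0" by (simp add: lorentz_def)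
  ultimately show ?thesis
    using descartes_expansion(2)[OF assms, of "(0, 0, -2)"] by simp
qed

lemma corona_poly_eq:
  "corona_poly (vector [vector [a, c], vector [b, d]]) B (m, n) =
   (of_int m)\<^sup>2 * (a\<^sup>2 + b\<^sup>2) + (of_int n)\<^sup>2 * (c\<^sup>2 + d\<^sup>2) + 2 * of_int m * of_int n * (a * c + b * d) - B"
  by (simp add: corona_poly_def matrix_matrix_mult_def matrix_vector_mult_def transpose_def
      inner_vec_def sum_2 vector_2 power2_eq_square algebra_simps)

text \<open>Distinct disks of a corona can share a curvature, so "twice" is expressed by a map onto
  the disks themselves whose fibers are the pairs \<open>f\<close>, \<open>- f\<close>.\<close>

theorem proposition3p4:
  fixes \<A> :: "gdisk set" and D E F :: gdisk
    and a b c d B :: real and M :: "real^2^2" and P :: "int \<times> int \<Rightarrow> real"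
  assumes "apollonian_packing \<A>"
    and "D \<in> \<A>" and "curvature D = B"
    and "E \<in> corona \<A> D" and "F \<in> corona \<A> D" and "tangent E F"
    and "tangency_spinor D E (Complex a b)"
    and "tangency_spinor D F (Complex c d)"
    and "M = vector [vector [a, c], vector [b, d]]"
    and "P = corona_poly M B"
  shows "P ` coprime_pairs = curvature ` corona \<A> D \<and>
         (\<forall>f. P (- f) = P f) \<and>
         (\<exists>\<phi>. \<phi> ` coprime_pairs = corona \<A> D \<and>
           (\<forall>f\<in>coprime_pairs. curvature (\<phi> f) = P f) \<and>
           (\<forall>f\<in>coprime_pairs. \<forall>g\<in>coprime_pairs. \<phi> f = \<phi> g \<longleftrightarrow> g = f \<or> g = - f))"
proof -
  obtain D1 D2 D3 where "mutually_tangent D1 D2 D3" and \<A>: "\<A> = apollonian_disks D1 D2 D3"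
    using assms(1) by (auto simp: apollonian_packing_def)
  then obtain Q0 where Q0: "descartes Q0"
    and inA: "\<And>Q k. reach {} Q0 Q \<Longrightarrow> vec_disk (Q k) \<in> \<A>"
    and Ain: "\<And>X. X \<in> \<A> \<Longrightarrow> valid_disk X \<and> (\<exists>Q k. reach {} Q0 Q \<and> disk_vec X = Q k)"
    using apollonian_disks_eq by metis
  have mem: "E \<in> \<A>" "F \<in> \<A>" and t: "tangent D E" "tangent D F"
    using assms(4,5) by (auto simp: corona_def)
  obtain QD QE QF iD iE iF where DEF: "reach {} Q0 QD" "disk_vec D = QD iD"
    "reach {} Q0 QE" "disk_vec E = QE iE" "reach {} Q0 QF" "disk_vec F = QF iF"
    using Ain assms(2) mem by metis
  have "lorentz (QD iD) (QE iE) = -1" "lorentz (QE iE) (QF iF) = -1" "lorentz (QD iD) (QF iF) = -1"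
    using t assms(6) unfolding DEF(2,4,6)[symmetric] by (auto intro: tangent_disk_vec)
  from triple_common[OF Q0 DEF(1,3,5) this]
  obtain Q' i j k where Q': "reach {} Q0 Q'" "i \<noteq> j" "k \<noteq> i" "k \<noteq> j"
    "Q' i = disk_vec D" "Q' j = disk_vec E" "Q' k = disk_vec F"
    using DEF by metis
  obtain l where l: "l \<noteq> i" "l \<noteq> j" "l \<noteq> k" using ex_index_not_in by blast
  have dist: "distinct [i, j, k, l]" using Q' l by auto
  \<comment> \<open>The mixed coefficient of the curvature form. The circle theorem makes its square
    four times the sum of pairwise products of the curvatures of \<open>D\<close>, \<open>E\<close>,
    \<open>F\<close>, and the spinor product has the same property up to the factor 2.\<close>
  let ?K = "\<lambda>Q. cv (Q l - Q i - Q j - Q k)"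
  have "(?K Q')\<^sup>2 = (2 * (a * c + b * d))\<^sup>2"
  proof -
    have "2 * ((cv (Q' i))\<^sup>2 + (cv (Q' j))\<^sup>2 + (cv (Q' k))\<^sup>2 + (cv (Q' l))\<^sup>2) =
        (cv (Q' i) + cv (Q' j) + cv (Q' k) + cv (Q' l))\<^sup>2"
      using descartes_circle_theorem[OF reach_descartes[OF Q'(1) Q0]] dist
      unfolding UNIV_eq_4[OF dist] by (simp add: add.assoc)
    moreover have "(a * c + b * d)\<^sup>2 =
        cv (Q' i) * cv (Q' j) + cv (Q' i) * cv (Q' k) + cv (Q' j) * cv (Q' k)"
      using tangency_spinor_inner[OF assms(7,8,6)] by (simp add: Q' cv_disk_vec)
    ultimately show ?thesis
      unfolding power_mult_distrib by (simp add: power2_eq_square algebra_simps)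
  qed
  then have sign: "?K Q' = 2 * (a * c + b * d) \<or> ?K Q' = - (2 * (a * c + b * d))"
    by (simp only: power2_eq_iff)
  \<comment> \<open>Of the two disks tangent to \<open>D\<close>, \<open>E\<close>, \<open>F\<close>, take the one whose spinor is \<open>u + v\<close>; the
    other has spinor \<open>u - v\<close>.\<close>
  obtain Q where Q: "reach {} Q0 Q" "Q i = disk_vec D" "Q j = disk_vec E" "Q k = disk_vec F"
    and K: "?K Q = 2 * (a * c + b * d)"
  proof (cases "?K Q' = 2 * (a * c + b * d)")
    case True
    then show ?thesis using that Q' by blast
  next
    case False
    \<comment> \<open>The exchange reflects the curvature at \<open>l\<close> about the sum of the
      other three.\<close>
    have "?K (flip l Q') = - ?K Q'"
      using l by (simp add: flip_eq[OF dist])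
    then have "?K (flip l Q') = 2 * (a * c + b * d)" using sign False by simp
    moreover have "reach {} Q0 (flip l Q')" using Q'(1) by (auto intro: reach.flip)
    ultimately show ?thesis using that[of "flip l Q'"] Q' l by simp
  qed
  have desc: "descartes Q" using Q(1) Q0 by (rule reach_descartes)
  have D: "vec_disk (Q i) = D" using Q Ain assms(2) by (simp add: vec_disk_disk_vec)
  define X where "X = corona_vec (Q i) (Q j) (Q k) (Q l)"
  define \<phi> where "\<phi> f = vec_disk (X (fst f) (snd f))" for f
  have norm_X: "lorentz (X m n) (X m n) = 1" for m n
    unfolding X_def lorentz_corona_vec(2)[OF desc dist] by (simp add: mult.commute)
  have P: "P (m, n) = (of_int m)\<^sup>2 * (B + curvature E) + (of_int n)\<^sup>2 * (B + curvature F)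
      + 2 * of_int m * of_int n * (a * c + b * d) - B" for m n
    using tangency_spinor_norm[OF assms(7)] tangency_spinor_norm[OF assms(8)] assms(3,9,10)
    by (simp add: corona_poly_eq)
  have curv: "curvature (\<phi> f) = P f" for f
  proof -
    obtain m n where f: "f = (m, n)" by (cases f)
    have "curvature (\<phi> f) = cv (X m n)"
      by (simp add: \<phi>_def f disk_vec_vec_disk norm_X flip: cv_disk_vec)
    also have "\<dots> = - cv (Q i) + (of_int m)\<^sup>2 * (cv (Q i) + cv (Q j))
        + (of_int n)\<^sup>2 * (cv (Q i) + cv (Q k)) + of_int m * of_int n * ?K Q"
      by (simp add: X_def corona_vec_def)
    also have "\<dots> = P f"
      unfolding K by (simp add: P f Q cv_disk_vec assms(3))
    finally show ?thesis .
  qed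
  have image: "\<phi> ` coprime_pairs = corona \<A> D"
  proof (intro equalityI subsetI)
    fix Y assume "Y \<in> \<phi> ` coprime_pairs"
    then obtain m n where mn: "coprime m n" "Y = vec_disk (X m n)"
      by (auto simp: coprime_pairs_def \<phi>_def)
    obtain R h where R: "reach {i} Q R" "h \<noteq> i" "R h = X m n"
      using corona_vec_in_frozen_family[OF desc dist mn(1)] unfolding X_def by blast
    have "reach {} Q0 R" using R(1) Q(1) by (meson reach_mono reach_trans empty_subsetI)
    then have "Y \<in> \<A>" using inA mn R by metis
    moreover have "R i = Q i" using reach_fixed[OF R(1)] by simp
    then have "tangent D Y"
      using descartes_tangent[OF reach_descartes[OF R(1) desc], of i h] R mn D by simp
    ultimately show "Y \<in> corona \<A> D" by (simp add: corona_def)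
  next
    fix Y assume Y: "Y \<in> corona \<A> D"
    then obtain R h where R: "reach {} Q0 R" "disk_vec Y = R h" and "valid_disk Y"
      using Ain[of Y] by (auto simp: corona_def)
    \<comment> \<open>With \<open>Q\<close> as base, tangency to \<open>D\<close> puts the disk into
      the family in which \<open>D\<close> is frozen, where all other disks are values of
      \<open>X\<close> at coprime pairs.\<close>
    have "reach {} Q R" using R(1) Q(1) by (meson reach_sym reach_trans)
    moreover have "lorentz (R h) (Q i) = -1"
      using Y tangent_disk_vec(1)[of D Y] by (simp add: corona_def Q lorentz_commute flip: R(2))
    ultimately obtain R' h' where R': "reach {i} Q R'" "R h = R' h'" "h' \<noteq> i"
      using tangent_in_common_quadruple[OF desc] by blast
    then obtain m n where "coprime m n" "R h = X m n"
      using frozen_family_subset_corona_vec[OF desc dist R'(1,3)] unfolding X_def by auto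
    moreover have "Y = vec_disk (R h)"
      using \<open>valid_disk Y\<close> by (simp add: vec_disk_disk_vec flip: R(2))
    ultimately show "Y \<in> \<phi> ` coprime_pairs"
      by (intro image_eqI[of _ _ "(m, n)"]) (auto simp: \<phi>_def coprime_pairs_def)
  qed
  have inj: "\<phi> f = \<phi> g \<longleftrightarrow> g = f \<or> g = - f" for f g
  proof -
    have "\<phi> f = \<phi> g \<longleftrightarrow> X (fst f) (snd f) = X (fst g) (snd g)"
      unfolding \<phi>_def by (metis disk_vec_vec_disk norm_X)
    then show ?thesis
      unfolding X_def corona_vec_eq_iff[OF desc dist] by (auto simp: prod_eq_iff)
  qed
  have "P ` coprime_pairs = curvature ` corona \<A> D"
    unfolding image[symmetric] image_image curv ..
  moreover have "P (- f) = P f" for f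
    by (cases f) (simp add: P)
  ultimately show ?thesis using image curv inj by blast
qed

end
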